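(* Let $G$ be an infinite, connected, vertex-transitive, $d$-regular directed graph (with symmetric edge set), and assume $G$ is amenable. Let $N$ be the number of infinite weak clusters. If $\theta(G,{\bf p})>0$, $p_0+p_1>0$ and $p_2>0$, then $P_{\bf p}(N=1)=1$.
   Context: $G=(V,E,o)$ is an infinite simple directed graph with origin $o\in V$: $V$ is countably infinite, $E\subset V\times V\setminus\{(x,x)\}$, and $(x,y)\in E$ iff $(y,x)\in E$; $x\sim y$ means $(x,y)\in E$; $L_x=\{y:(x,y)\in E\}$. $G$ is $d$-regular ($|L_x|=d$ for all $x$), connected with respect to $\sim$, and vertex-transitive (automorphisms act transitively on $V$). $G$ is amenable if there exist non-empty finite subsets $F(n)\subset V$ with $\limsup_{n\to\infty}|\partial F(n)|/|F(n)|=0$, where $\partial F(n)=\{x\in F(n):\text{there is }y\in V\setminus F(n)\text{ with }x\sim y\}$. Let ${\bf p}=(p_0,\dots,p_d)$ with $p_i\ge0$ and $\sum_i p_i=1$. Configurations are $\omega\in\Omega=\prod_{x\in V}2^{L_x}$ with the $\sigma$-field generated by finite-dimensional cylinders; $P_{\bf p}$ is the product measure under which the states $\omega(x)\subset L_x$ are independent with $P_{\bf p}(\omega(x)=S)=p_{|S|}/\binom{d}{|S|}$ for $S\subset L_x$. Put $E_\omega=\{(x,y):x\in V,\ y\in\omega(x)\}$. Vertices $x,y$ are weakly connected if $x=y$ or there are $x=z_0,\dots,z_m=y$ such that for each $i$, $(z_i,z_{i+1})\in E_\omega$ or $(z_{i+1},z_i)\in E_\omega$. Weak clusters are the equivalence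 classes of weak connection. $C$ is the weak cluster of $o$ and $\theta(G,{\bf p})=P_{\bf p}(|C|=\infty)$. *)

theory Defs
  imports "HOL-Probability.Probability" "HOL-Library.Extended_Nat"
begin

section \<open>Vertex-transitive regular graphs\<close>

definition nbrs :: "('v \<times> 'v) set \<Rightarrow> 'v \<Rightarrow> 'v set" where
  "nbrs E x = {y. (x, y) \<in> E}"

definition simple_digraph :: "'v set \<Rightarrow> ('v \<times> 'v) set \<Rightarrow> bool" where
  "simple_digraph V E \<longleftrightarrow> E \<subseteq> V \<times> V \<and> irrefl E \<and> sym E"

text \<open>Finiteness is explicit because \<open>card\<close> of an infinite set is \<open>0\<close>.\<close>

definition regular_graph :: "'v set \<Rightarrow> ('v \<times> 'v) set \<Rightarrow> nat \<Rightarrow> bool" where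
  "regular_graph V E d \<longleftrightarrow> (\<forall>x\<in>V. finite (nbrs E x) \<and> card (nbrs E x) = d)"

definition connected_graph :: "'v set \<Rightarrow> ('v \<times> 'v) set \<Rightarrow> bool" where
  "connected_graph V E \<longleftrightarrow> (\<forall>x\<in>V. \<forall>y\<in>V. (x, y) \<in> E\<^sup>*)"

definition graph_automorphism :: "'v set \<Rightarrow> ('v \<times> 'v) set \<Rightarrow> ('v \<Rightarrow> 'v) \<Rightarrow> bool" where
  "graph_automorphism V E f \<longleftrightarrow>
     bij_betw f V V \<and> (\<forall>x\<in>V. \<forall>y\<in>V. (x, y) \<in> E \<longleftrightarrow> (f x, f y) \<in> E)"

definition vertex_transitive :: "'v set \<Rightarrow> ('v \<times> 'v) set \<Rightarrow> bool" where
  "vertex_transitive V E \<longleftrightarrow> (\<forall>x\<in>V. \<forall>y\<in>V. \<exists>f. graph_automorphism V E f \<and> f x = y)"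

definition inner_boundary :: "'v set \<Rightarrow> ('v \<times> 'v) set \<Rightarrow> 'v set \<Rightarrow> 'v set" where
  "inner_boundary V E F = {x \<in> F. \<exists>y \<in> V - F. (x, y) \<in> E}"

definition amenable_graph :: "'v set \<Rightarrow> ('v \<times> 'v) set \<Rightarrow> bool" where
  "amenable_graph V E \<longleftrightarrow>
     (\<exists>F :: nat \<Rightarrow> 'v set.
        (\<forall>n. F n \<noteq> {} \<and> finite (F n) \<and> F n \<subseteq> V) \<and>
        limsup (\<lambda>n. ereal (real (card (inner_boundary V E (F n))) / real (card (F n)))) = 0)"

section \<open>Random configurations\<close>

definition prob_vector :: "nat \<Rightarrow> (nat \<Rightarrow> real) \<Rightarrow> bool" where
  "prob_vector d p \<longleftrightarrow> (\<forall>i\<le>d. 0 \<le> p i) \<and> (\<Sum>i\<le>d. p i) = 1"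

definition state_measure :: "('v \<times> 'v) set \<Rightarrow> nat \<Rightarrow> (nat \<Rightarrow> real) \<Rightarrow> 'v \<Rightarrow> 'v set measure" where
  "state_measure E d p x =
     point_measure (Pow (nbrs E x)) (\<lambda>S. ennreal (p (card S) / real (d choose card S)))"

text \<open>
  The space of this measure is \<open>\<Pi>\<^sub>E x\<in>V. Pow (nbrs E x)\<close>. Each factor carries the discrete
  \<open>\<sigma>\<close>-algebra, so the product \<open>\<sigma>\<close>-algebra is the one generated by the cylinder sets.
\<close>

definition config_measure ::
    "'v set \<Rightarrow> ('v \<times> 'v) set \<Rightarrow> nat \<Rightarrow> (nat \<Rightarrow> real) \<Rightarrow> ('v \<Rightarrow> 'v set) measure" where
  "config_measure V E d p = (\<Pi>\<^sub>M x\<in>V. state_measure E d p x)"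

section \<open>Weak clusters\<close>

definition config_arcs :: "'v set \<Rightarrow> ('v \<Rightarrow> 'v set) \<Rightarrow> ('v \<times> 'v) set" where
  "config_arcs V \<omega> = {(x, y). x \<in> V \<and> y \<in> \<omega> x}"

definition weak_conn :: "'v set \<Rightarrow> ('v \<Rightarrow> 'v set) \<Rightarrow> ('v \<times> 'v) set" where
  "weak_conn V \<omega> = (config_arcs V \<omega> \<union> (config_arcs V \<omega>)\<inverse>)\<^sup>* \<inter> V \<times> V"

definition weak_clusters :: "'v set \<Rightarrow> ('v \<Rightarrow> 'v set) \<Rightarrow> 'v set set" where
  "weak_clusters V \<omega> = V // weak_conn V \<omega>"

definition weak_cluster_of :: "'v set \<Rightarrow> ('v \<Rightarrow> 'v set) \<Rightarrow> 'v \<Rightarrow> 'v set" where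
  "weak_cluster_of V \<omega> x = weak_conn V \<omega> `` {x}"

definition percolation_prob ::
    "'v set \<Rightarrow> ('v \<times> 'v) set \<Rightarrow> 'v \<Rightarrow> nat \<Rightarrow> (nat \<Rightarrow> real) \<Rightarrow> real" where
  "percolation_prob V E v\<^sub>0 d p =
     measure (config_measure V E d p)
       {\<omega> \<in> space (config_measure V E d p). infinite (weak_cluster_of V \<omega> v\<^sub>0)}"

definition num_infinite_clusters :: "'v set \<Rightarrow> ('v \<Rightarrow> 'v set) \<Rightarrow> enat" where
  "num_infinite_clusters V \<omega> =
     (let I = {C \<in> weak_clusters V \<omega>. infinite C} in if finite I then enat (card I) else \<infinity>)"

end

theory Submission
  imports Defs
begin

text \<open>
  The events that there are at least one, two or three infinite weak clusters are invariant under
  automorphisms, so each has probability 0 or 1. Changing finitely many states to states of positive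
  weight preserves almost sure events, which excludes two remaining cases.

  Exactly two infinite clusters: since a state of size 0 or 1 and a state of size 2 are available,
  finitely many changes bring the two clusters next to each other and then join them.

  At least three: states of size 2 suffice to turn some finite set into a trifurcation, that is, a
  connected set whose removal leaves three infinite pieces attached to it. By invariance a finite
  set \<open>F\<close> then meets in mean a positive multiple of \<open>card F\<close> disjoint trifurcations. Following Burton
  and Keane, disjoint trifurcations in the interior of \<open>F\<close> are at most as many as the boundary
  vertices of \<open>F\<close>, which contradicts amenability.
\<close>

subsection \<open>Components and branches of a graph\<close>

text \<open>The graph surgery is deterministic. An almost sure property is replaced by a non-empty
  set of configurations on which it holds everywhere and which is stable under changing one state to
  an allowed one; the cluster arguments then need no probabilities.

  The obstacle is that a state cannot be edited arc by arc: a vertex chooses its whole out-set at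
  once, and only certain sizes have positive weight. Adding one arc may thus destroy others and
  split a cluster. For two clusters, the small state gives access to a configuration lying below
  both the old one and the joined one, in which all infinite clusters are accounted for. For three,
  states of size 2 give little control over a single branching vertex, so the branching object is a
  finite connected set.

  Disjointness of trifurcations is enforced by admitting only centres whose balls of radius
  \<open>r\<close> are disjoint. Every finite set contains such centres in at least a fixed
  proportion, so this costs a constant factor only.\<close>

definition conn_in :: "('v \<times> 'v) set \<Rightarrow> 'v set \<Rightarrow> ('v \<times> 'v) set" where
  "conn_in R W = (R \<inter> W \<times> W)\<^sup>*"

text \<open>Deleting a set \<open>B\<close> is expressed by taking \<open>W = V - B\<close>. The
  closure is reflexive everywhere, so a vertex outside \<open>W\<close> is its own component; this
  is why membership in \<open>W\<close> is often assumed separately.\<close>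

definition comp_in :: "('v \<times> 'v) set \<Rightarrow> 'v set \<Rightarrow> 'v \<Rightarrow> 'v set" where
  "comp_in R W x = conn_in R W `` {x}"

lemma comp_in_iff: "y \<in> comp_in R W x \<longleftrightarrow> (x, y) \<in> conn_in R W"
  by (simp add: comp_in_def)

lemma conn_in_refl [simp]: "(x, x) \<in> conn_in R W"
  by (simp add: conn_in_def)

lemma comp_in_self [simp]: "x \<in> comp_in R W x"
  by (simp add: comp_in_iff)

lemma conn_in_step: "(x, y) \<in> R \<Longrightarrow> x \<in> W \<Longrightarrow> y \<in> W \<Longrightarrow> (x, y) \<in> conn_in R W"
  by (auto simp: conn_in_def)

lemma conn_in_trans: "(x, y) \<in> conn_in R W \<Longrightarrow> (y, z) \<in> conn_in R W \<Longrightarrow> (x, z) \<in> conn_in R W"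
  unfolding conn_in_def by (rule rtrancl_trans)

lemma conn_in_sym: "sym R \<Longrightarrow> (x, y) \<in> conn_in R W \<Longrightarrow> (y, x) \<in> conn_in R W"
  unfolding conn_in_def
  by (rule symD[OF sym_rtrancl[of "R \<inter> W \<times> W"]]) (auto simp: sym_def)

lemma conn_in_mono:
  assumes "R \<inter> W \<times> W \<subseteq> R' \<inter> W' \<times> W'"
  shows "conn_in R W \<subseteq> conn_in R' W'"
  unfolding conn_in_def using assms by (rule rtrancl_mono)

lemma comp_in_mono: "R \<inter> W \<times> W \<subseteq> R' \<inter> W' \<times> W' \<Longrightarrow> comp_in R W x \<subseteq> comp_in R' W' x"
  using conn_in_mono[of R W R' W'] by (auto simp: comp_in_def)

lemma conn_in_mem: "(x, y) \<in> conn_in R W \<Longrightarrow> x \<in> W \<Longrightarrow> y \<in> W"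
  unfolding conn_in_def by (erule rtranclE) simp_all

lemma comp_in_subset: "x \<in> W \<Longrightarrow> comp_in R W x \<subseteq> W"
  unfolding comp_in_iff subset_iff by (blast intro: conn_in_mem)

lemma comp_in_eq: "sym R \<Longrightarrow> (x, y) \<in> conn_in R W \<Longrightarrow> comp_in R W x = comp_in R W y"
  unfolding set_eq_iff comp_in_iff by (meson conn_in_trans conn_in_sym)

lemma infinite_comp_in_cong:
  "sym R \<Longrightarrow> (x, y) \<in> conn_in R W \<Longrightarrow> infinite (comp_in R W x) \<Longrightarrow> infinite (comp_in R W y)"
  by (simp add: comp_in_eq)

lemma comp_in_step:
  "y \<in> comp_in R W x \<Longrightarrow> (y, z) \<in> R \<Longrightarrow> y \<in> W \<Longrightarrow> z \<in> W \<Longrightarrow> z \<in> comp_in R W x"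
  unfolding comp_in_iff by (rule conn_in_trans[OF _ conn_in_step])

text \<open>A path from \<open>x\<close> visits only the component of \<open>x\<close>, so it
  survives in every vertex set containing that component. It is used to keep clusters that avoid the
  vertices being altered or deleted.\<close>

lemma conn_in_within_comp:
  assumes "sym R" "y \<in> comp_in R W x" "x \<in> W" "comp_in R W x \<subseteq> W'"
  shows "(x, y) \<in> conn_in R W'"
proof -
  have "(x, y) \<in> conn_in R W" using assms(2) by (simp add: comp_in_iff)
  then show ?thesis unfolding conn_in_def
  proof (induction rule: rtrancl_induct)
    case (step y z)
    then have "y \<in> comp_in R W x" "z \<in> comp_in R W x"
      by (auto simp: comp_in_iff conn_in_def intro: rtrancl_into_rtrancl)
    with assms step show ?case by (auto intro: rtrancl_into_rtrancl)
  qed simp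
qed

text \<open>Cut a path at its last visit to \<open>D\<close>.\<close>

lemma conn_in_last_exit:
  assumes "(z, u) \<in> conn_in R W" "z \<in> D" "z \<in> W"
  shows "u \<in> D \<or> (\<exists>z'\<in>D \<inter> comp_in R W z. \<exists>y\<in>W - D. (z', y) \<in> R \<and> u \<in> comp_in R (W - D) y)"
  using assms(1) unfolding conn_in_def
proof (induction rule: rtrancl_induct)
  case base
  then show ?case using assms by simp
next
  case (step u v)
  have zu: "u \<in> comp_in R W z" using step(1) by (simp add: comp_in_iff conn_in_def)
  show ?case
  proof (cases "v \<in> D")
    case False
    show ?thesis
    proof (cases "u \<in> D")
      case True
      then show ?thesis using step False zu by (intro disjI2 bexI[of _ u] bexI[of _ v]) auto
    next
      case uD: False
      with step obtain z' y where *: "z' \<in> D \<inter> comp_in R W z" "y \<in> W - D" "(z', y) \<in> R"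
        "u \<in> comp_in R (W - D) y" by blast
      have "v \<in> comp_in R (W - D) y"
        using step(2) uD False by (intro comp_in_step[OF *(4)]) auto
      with * show ?thesis by blast
    qed
  qed simp
qed

text \<open>By the last-exit decomposition the component is covered by \<open>D\<close> and the
  pieces entered from \<open>D\<close>. Finiteness of \<open>D\<close> and of the degrees leaves
  finitely many pieces, so one is infinite. The arc into it is recorded because the surgery needs an
  attachment point.\<close>

lemma infinite_comp_minus_finite:
  assumes "sym R" and lf: "\<And>z. finite (R `` {z})"
    and "infinite (comp_in R W x)" "z \<in> D" "finite D" "z \<in> W" "z \<in> comp_in R W x"
  obtains z' y where "z' \<in> D" "z' \<in> comp_in R W x" "y \<in> W - D" "(z', y) \<in> R"
    "y \<in> comp_in R W x" "infinite (comp_in R (W - D) y)"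
proof -
  have eq: "comp_in R W x = comp_in R W z"
    using assms by (intro comp_in_eq) (auto simp: comp_in_iff)
  let ?Y = "\<lambda>z'. R `` {z'} \<inter> (W - D)"
  have sub: "comp_in R W z \<subseteq> D \<union> (\<Union>z'\<in>D \<inter> comp_in R W z. \<Union>y\<in>?Y z'. comp_in R (W - D) y)"
    using conn_in_last_exit[OF _ \<open>z \<in> D\<close> \<open>z \<in> W\<close>, of _ R] by (fastforce simp: comp_in_iff[of _ R W])
  have "\<exists>z'\<in>D \<inter> comp_in R W z. \<exists>y\<in>?Y z'. infinite (comp_in R (W - D) y)"
  proof (rule ccontr)
    assume "\<not> ?thesis"
    then have "finite (D \<union> (\<Union>z'\<in>D \<inter> comp_in R W z. \<Union>y\<in>?Y z'. comp_in R (W - D) y))"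
      using \<open>finite D\<close> lf by auto
    with sub assms(3) eq finite_subset show False by metis
  qed
  then obtain z' y where *: "z' \<in> D" "z' \<in> comp_in R W z" "y \<in> W - D" "(z', y) \<in> R"
    "infinite (comp_in R (W - D) y)" by auto
  have "z' \<in> W" using *(2) \<open>z \<in> W\<close> comp_in_subset by fastforce
  with * have "y \<in> comp_in R W z"
    by (intro comp_in_step[OF *(2)]) auto
  with * eq show ?thesis using that[of z' y] by simp
qed

lemma infinite_comp_avoiding_finite:
  assumes "sym R" "\<And>z. finite (R `` {z})" "infinite (comp_in R W x)" "finite D" "D \<subseteq> W" "x \<in> W"
  obtains y where "y \<in> W - D" "y \<in> comp_in R W x" "infinite (comp_in R (W - D) y)"
proof (cases "D \<inter> comp_in R W x = {}")
  case True
  have "(x, y) \<in> conn_in R (W - D)" if "y \<in> comp_in R W x" for y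
    using that assms True comp_in_subset[of x W R] by (intro conn_in_within_comp[of R y W x]) auto
  then have "comp_in R W x \<subseteq> comp_in R (W - D) x" by (auto simp: comp_in_iff)
  then have "infinite (comp_in R (W - D) x)" using assms(3) infinite_super by blast
  moreover have "x \<in> W - D" using True assms(6) comp_in_self[of x R W] by auto
  ultimately show ?thesis using that[of x] by simp
next
  case False
  then obtain z where z: "z \<in> D" "z \<in> comp_in R W x" by blast
  then have "z \<in> W" using assms by blast
  from infinite_comp_minus_finite[OF assms(1,2,3) z(1) assms(4) this z(2)] that
  show ?thesis by blast
qed

section \<open>Branches attached to a connected set\<close>

definition branch :: "('v \<times> 'v) set \<Rightarrow> 'v set \<Rightarrow> 'v set \<Rightarrow> 'v set \<Rightarrow> bool" where
  "branch R V B A \<longleftrightarrow> (\<exists>w\<in>V - B. (\<exists>b\<in>B. (b, w) \<in> R) \<and> A = comp_in R (V - B) w)"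

definition connected_in :: "('v \<times> 'v) set \<Rightarrow> 'v set \<Rightarrow> bool" where
  "connected_in R B \<longleftrightarrow> (\<forall>x\<in>B. \<forall>y\<in>B. (x, y) \<in> conn_in R B)"

lemma connected_in_comp_in:
  assumes "sym R" "connected_in R B" "B \<subseteq> W" "b \<in> B" "b \<in> comp_in R W w"
  shows "B \<subseteq> comp_in R W w"
proof
  fix c assume "c \<in> B"
  with assms have "(b, c) \<in> conn_in R B" by (auto simp: connected_in_def)
  moreover have "conn_in R B \<subseteq> conn_in R W" using assms by (intro conn_in_mono) auto
  ultimately show "c \<in> comp_in R W w"
    using assms(5) conn_in_trans[of w b R W c] by (auto simp: comp_in_iff)
qed

lemma connected_in_Un:
  assumes "sym R" "connected_in R A" "connected_in R B" "a \<in> A" "b \<in> B" "(a, b) \<in> R"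
  shows "connected_in R (A \<union> B)"
  unfolding connected_in_def
proof (intro ballI)
  have m: "conn_in R A \<subseteq> conn_in R (A \<union> B)" "conn_in R B \<subseteq> conn_in R (A \<union> B)"
    by (auto intro!: conn_in_mono)
  have ab: "(a, b) \<in> conn_in R (A \<union> B)" using assms by (intro conn_in_step) auto
  have *: "(x, b) \<in> conn_in R (A \<union> B)" if "x \<in> A \<union> B" for x
  proof (cases "x \<in> A")
    case True
    then have "(x, a) \<in> conn_in R A" using assms by (auto simp: connected_in_def)
    with m ab show ?thesis by (meson conn_in_trans subsetD)
  next
    case False
    with that have "(x, b) \<in> conn_in R B" using assms by (auto simp: connected_in_def)
    with m show ?thesis by blast
  qed
  fix x y assume "x \<in> A \<union> B" "y \<in> A \<union> B"
  then show "(x, y) \<in> conn_in R (A \<union> B)"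
    using *[of x] conn_in_sym[OF assms(1) *[of y]] conn_in_trans by metis
qed

lemma connected_in_comp:
  assumes "sym R" "w \<in> W"
  shows "connected_in R (comp_in R W w)"
  unfolding connected_in_def
proof (intro ballI)
  fix x y assume "x \<in> comp_in R W w" "y \<in> comp_in R W w"
  then have "(w, x) \<in> conn_in R (comp_in R W w)" "(w, y) \<in> conn_in R (comp_in R W w)"
    using assms by (auto intro: conn_in_within_comp)
  then show "(x, y) \<in> conn_in R (comp_in R W w)"
    using conn_in_sym[OF assms(1)] conn_in_trans by metis
qed

lemma branch_disjoint:
  assumes "sym R" "branch R V B A" "branch R V B A'" "A \<noteq> A'"
  shows "A \<inter> A' = {}"
proof (rule ccontr)
  obtain w w' where w: "A = comp_in R (V - B) w" "A' = comp_in R (V - B) w'"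
    using assms(2,3) unfolding branch_def by blast
  assume "A \<inter> A' \<noteq> {}"
  then obtain c where "(w, c) \<in> conn_in R (V - B)" "(w', c) \<in> conn_in R (V - B)"
    using w by (auto simp: comp_in_iff)
  then show False using comp_in_eq[OF assms(1)] assms(4) w by metis
qed

lemma branch_subset: "branch R V B A \<Longrightarrow> A \<subseteq> V - B"
  unfolding branch_def by (elim bexE conjE) (simp add: comp_in_subset)

text \<open>A branch is a full component outside \<open>B\<close> and can only be left through
  \<open>B\<close>. Hence, of two disjoint connected sets, each lies inside one branch of the other
  or misses all of them.\<close>

lemma branch_absorbs:
  assumes "sym R" "branch R V B A" "connected_in R C" "C \<subseteq> V" "C \<inter> B = {}" "C \<inter> A \<noteq> {}"
  shows "C \<subseteq> A"
proof -
  obtain w where w: "A = comp_in R (V - B) w" using assms(2) unfolding branch_def by blast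
  obtain c where "c \<in> C" "c \<in> A" using assms(6) by blast
  then show ?thesis
    using connected_in_comp_in[of R C "V - B" c w] assms w by auto
qed

text \<open>Provides the connected sets to which \<open>branch_absorbs\<close> is applied for
  another trifurcation: a branch of the latter that catches part of \<open>A \<union> B\<close>
  swallows all of it.\<close>

lemma branch_Un_connected:
  assumes "sym R" "branch R V B A" "connected_in R B" "B \<subseteq> V"
  shows "connected_in R (A \<union> B)"
proof -
  obtain w b where w: "w \<in> V - B" "A = comp_in R (V - B) w" "b \<in> B" "(b, w) \<in> R"
    using assms(2) unfolding branch_def by blast
  then show ?thesis
    using connected_in_Un[of R A B w b] connected_in_comp[of R w "V - B"] assms
    by (auto dest: symD)
qed

text \<open>
  Some branch \<open>A\<close> of some \<open>B \<in> \<T>\<close> contains no other member of \<open>\<T>\<close>;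
  deleting \<open>B\<close> from \<open>\<T>\<close> and \<open>A\<close> from \<open>Y\<close> preserves the hypotheses, because a branch of \<open>C\<close> that
  contains \<open>B\<close> also contains a further branch of \<open>B\<close>.
\<close>

lemma card_trifurcations_le:
  fixes R :: "('v \<times> 'v) set"
  assumes "sym R" "finite \<T>" "finite Y"
    and "\<And>B. B \<in> \<T> \<Longrightarrow> B \<noteq> {} \<and> B \<subseteq> V \<and> connected_in R B"
    and "\<And>B B'. B \<in> \<T> \<Longrightarrow> B' \<in> \<T> \<Longrightarrow> B \<noteq> B' \<Longrightarrow> B \<inter> B' = {}"
    and "\<And>B. B \<in> \<T> \<Longrightarrow> \<exists>A1 A2 A3. A1 \<noteq> A2 \<and> A1 \<noteq> A3 \<and> A2 \<noteq> A3 \<and>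
           (\<forall>A\<in>{A1, A2, A3}. branch R V B A \<and> A \<inter> Y \<noteq> {})"
  shows "card \<T> \<le> card Y"
  using assms(2-)
proof (induction "card \<T>" arbitrary: \<T> Y)
  case 0
  then show ?case by simp
next
  case (Suc n)
  note fin = Suc.prems(1,2) and conn = Suc.prems(3) and disj = Suc.prems(4) and three = Suc.prems(5)
  \<comment> \<open>At least two of the three branches differ from \<open>A0\<close>. They are
    disjoint, and each contains \<open>C\<close> entirely or misses it, so one of them misses the
    non-empty \<open>C\<close>.\<close>
  have away: "\<exists>A. branch R V B A \<and> A \<inter> Y \<noteq> {} \<and> A \<noteq> A0 \<and> A \<inter> C = {}"
    if B: "B \<in> \<T>" and "C \<in> \<T>" "B \<noteq> C" for B C A0
  proof -
    obtain A1 A2 A3 where A123: "A1 \<noteq> A2 \<and> A1 \<noteq> A3 \<and> A2 \<noteq> A3 \<and>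
        (\<forall>A\<in>{A1, A2, A3}. branch R V B A \<and> A \<inter> Y \<noteq> {})"
      using three[OF B] by (elim exE)
    then have A: "branch R V B D \<and> D \<inter> Y \<noteq> {}" if "D \<in> {A1, A2, A3}" for D
      using that by blast
    have "\<exists>D\<in>{A1, A2, A3}. \<exists>D'\<in>{A1, A2, A3}. D \<noteq> D' \<and> D \<noteq> A0 \<and> D' \<noteq> A0"
      using A123 by auto
    then obtain D D' where D: "D \<in> {A1, A2, A3}" "D' \<in> {A1, A2, A3}" "D \<noteq> D'" "D \<noteq> A0" "D' \<noteq> A0"
      by (elim bexE conjE)
    have "D \<inter> D' = {}" using branch_disjoint[OF assms(1)] A D by blast
    moreover have "C \<subseteq> D" if "D \<inter> C \<noteq> {}"
      using branch_absorbs[OF assms(1), of V B D C] A[OF D(1)] conn[OF \<open>C \<in> \<T>\<close>]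
        disj[OF \<open>C \<in> \<T>\<close> \<open>B \<in> \<T>\<close>] that \<open>B \<noteq> C\<close> by blast
    moreover have "C \<subseteq> D'" if "D' \<inter> C \<noteq> {}"
      using branch_absorbs[OF assms(1), of V B D' C] A[OF D(2)] conn[OF \<open>C \<in> \<T>\<close>]
        disj[OF \<open>C \<in> \<T>\<close> \<open>B \<in> \<T>\<close>] that \<open>B \<noteq> C\<close> by blast
    ultimately have "D \<inter> C = {} \<or> D' \<inter> C = {}" using conn[OF \<open>C \<in> \<T>\<close>] by blast
    then show ?thesis
    proof
      assume "D \<inter> C = {}"
      with A[OF D(1)] D(4) show ?thesis by blast
    next
      assume "D' \<inter> C = {}"
      with A[OF D(2)] D(5) show ?thesis by blast
    qed
  qed
  define S where "S = {(B, A). B \<in> \<T> \<and> branch R V B A \<and> A \<inter> Y \<noteq> {}}"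
  \<comment> \<open>A branch with the fewest members inside it contains none: a member
    \<open>C\<close> inside \<open>A\<close> has a branch \<open>A'\<close> inside \<open>A\<close>,
    which no longer contains \<open>C\<close> itself and so has a smaller count.\<close>
  define m where "m = (\<lambda>(B :: 'v set, A). card {C \<in> \<T>. C \<subseteq> A})"
  obtain B0 where "B0 \<in> \<T>" using Suc(2) by fastforce
  from three[OF this] obtain A0 where "(B0, A0) \<in> S"
    unfolding S_def using \<open>B0 \<in> \<T>\<close> by auto
  then obtain P where "P \<in> S" and least: "\<And>Q. Q \<in> S \<Longrightarrow> m P \<le> m Q"
    using ex_has_least_nat[of "\<lambda>Q. Q \<in> S" "(B0, A0)" m] by blast
  then obtain B A where P: "P = (B, A)" "B \<in> \<T>" "branch R V B A" "A \<inter> Y \<noteq> {}"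
    unfolding S_def by blast
  have free: "A \<inter> C = {}" if CT: "C \<in> \<T>" for C
  proof (rule ccontr)
    assume ne: "A \<inter> C \<noteq> {}"
    then have "C \<noteq> B" using branch_subset[OF P(3)] by blast
    then have CA: "C \<subseteq> A"
      using branch_absorbs[OF assms(1) P(3)] conn[OF CT] disj[OF CT P(2)] ne by blast
    \<comment> \<open>\<open>{}\<close> is a placeholder for the branch to be avoided: any branch of
      \<open>C\<close> that misses \<open>B\<close> will do.\<close>
    obtain A' where A': "branch R V C A'" "A' \<inter> Y \<noteq> {}" "A' \<inter> B = {}"
      using away[OF CT P(2) \<open>C \<noteq> B\<close>, of "{}"] by blast
    have "connected_in R (A' \<union> C)"
      using branch_Un_connected[OF assms(1) A'(1)] conn[OF CT] by blast
    then have "A' \<union> C \<subseteq> A"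
      using branch_absorbs[OF assms(1) P(3), of "A' \<union> C"] A'(3) branch_subset[OF A'(1)]
        conn[OF CT] disj[OF CT P(2) \<open>C \<noteq> B\<close>] CA by blast
    moreover have "A' \<inter> C = {}" using branch_subset[OF A'(1)] by blast
    ultimately have "{D \<in> \<T>. D \<subseteq> A'} \<subset> {D \<in> \<T>. D \<subseteq> A}" using CT conn[OF CT] by blast
    then have "m (C, A') < m P" unfolding m_def P(1) using fin by (simp add: psubset_card_mono)
    moreover have "(C, A') \<in> S" using CT A' by (simp add: S_def)
    ultimately show False using least by fastforce
  qed
  have "card (\<T> - {B}) \<le> card (Y - A)"
  proof (rule Suc.hyps(1))
    fix C assume "C \<in> \<T> - {B}"
    then have C: "C \<in> \<T>" "B \<noteq> C" by auto
    obtain A' where A': "branch R V B A'" "A' \<inter> Y \<noteq> {}" "A' \<noteq> A" "A' \<inter> C = {}"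
      using away[OF P(2) C, of A] by blast
    have AA': "A' \<inter> A = {}" using branch_disjoint[OF assms(1)] A' P(3) by blast
    have BC: "B \<inter> C = {}" using disj P(2) C by blast
    have con: "connected_in R (A \<union> B)" "connected_in R (A' \<union> B)"
      using branch_Un_connected[OF assms(1)] P A'(1) conn[OF P(2)] by blast+
    have keep: "D \<inter> (Y - A) \<noteq> {}" if D: "branch R V C D" "D \<inter> Y \<noteq> {}" for D
    proof (cases "D \<inter> A = {}")
      case False
      then have "A \<union> B \<subseteq> D"
        using branch_absorbs[OF assms(1) D(1) con(1)] free[OF C(1)] BC conn[OF P(2)]
          branch_subset[OF P(3)] by blast
      then have "A' \<union> B \<subseteq> D"
        using branch_absorbs[OF assms(1) D(1) con(2)] A'(4) BC conn[OF P(2)]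
          branch_subset[OF A'(1)] by blast
      then show ?thesis using A' AA' by blast
    qed (use D in blast)
    from three[OF C(1)] obtain A1 A2 A3 where D: "A1 \<noteq> A2" "A1 \<noteq> A3" "A2 \<noteq> A3"
      "\<forall>D\<in>{A1, A2, A3}. branch R V C D \<and> D \<inter> Y \<noteq> {}"
      by (elim exE conjE)
    have "\<forall>D\<in>{A1, A2, A3}. branch R V C D \<and> D \<inter> (Y - A) \<noteq> {}"
      using D(4) keep by (intro ballI conjI) auto
    with D(1-3) show "\<exists>A1 A2 A3. A1 \<noteq> A2 \<and> A1 \<noteq> A3 \<and> A2 \<noteq> A3 \<and>
           (\<forall>D\<in>{A1, A2, A3}. branch R V C D \<and> D \<inter> (Y - A) \<noteq> {})"
      by (intro exI[of _ A1] exI[of _ A2] exI[of _ A3] conjI)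
  qed (use Suc.hyps(2) fin conn disj P(2) in auto)
  \<comment> \<open>The vertices of \<open>Y\<close> lost with \<open>A\<close>, at least one, pay
    for the removal of \<open>B\<close>.\<close>
  moreover have "card (Y - A) < card Y"
    using P(4) fin by (intro psubset_card_mono) auto
  ultimately show ?case using P(2) fin by (simp add: card_Diff_singleton_if)
qed

subsection \<open>Balls and automorphisms\<close>

lemma conn_in_map:
  assumes "(x, y) \<in> conn_in R W" "\<And>a b. (a, b) \<in> R \<inter> W \<times> W \<Longrightarrow> (f a, f b) \<in> R' \<inter> W' \<times> W'"
  shows "(f x, f y) \<in> conn_in R' W'"
  using assms(1) unfolding conn_in_def
proof (induction rule: rtrancl_induct)
  case (step y z)
  with assms(2)[of y z] show ?case by (auto intro: rtrancl_into_rtrancl)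
qed simp

text \<open>Automorphisms are controlled on \<open>V\<close> only; injectivity there and
  \<open>R \<subseteq> V \<times> V\<close> allow a path in the image to be pulled back step by
  step.\<close>

lemma comp_in_image:
  assumes "inj_on f V" "R \<subseteq> V \<times> V" "W \<subseteq> V" "x \<in> V"
  shows "comp_in (map_prod f f ` R) (f ` W) (f x) = f ` comp_in R W x"
proof (intro equalityI subsetI)
  fix z assume "z \<in> f ` comp_in R W x"
  then obtain y where "z = f y" and y: "(x, y) \<in> conn_in R W" by (auto simp: comp_in_iff)
  moreover have "(f x, f y) \<in> conn_in (map_prod f f ` R) (f ` W)"
    by (rule conn_in_map[OF y]) auto
  ultimately show "z \<in> comp_in (map_prod f f ` R) (f ` W) (f x)" by (simp add: comp_in_iff)
next
  fix z assume "z \<in> comp_in (map_prod f f ` R) (f ` W) (f x)"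
  then have "(f x, z) \<in> (map_prod f f ` R \<inter> f ` W \<times> f ` W)\<^sup>*" by (simp add: comp_in_iff conn_in_def)
  then have "\<exists>y\<in>V. z = f y \<and> (x, y) \<in> conn_in R W"
  proof (induction rule: rtrancl_induct)
    case base
    show ?case using assms by (intro bexI[of _ x]) auto
  next
    case (step z z')
    then obtain y where y: "y \<in> V" "z = f y" "(x, y) \<in> conn_in R W" by blast
    from step(2) obtain a b where ab: "(a, b) \<in> R" "z = f a" "z' = f b" by auto
    have "a \<in> V" "b \<in> V" using ab assms by auto
    with step(2) y ab assms have "a = y" "b \<in> W" "y \<in> W"
      by (auto simp: inj_on_eq_iff inj_on_image_mem_iff)
    with y ab \<open>b \<in> V\<close> conn_in_trans[OF y(3) conn_in_step] show ?case by blast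
  qed
  then show "z \<in> f ` comp_in R W x" by (auto simp: comp_in_iff)
qed

lemma comp_in_subset_field:
  assumes "R \<subseteq> V \<times> V" "x \<in> V"
  shows "comp_in R W x \<subseteq> V"
proof
  fix y assume "y \<in> comp_in R W x"
  then have "(x, y) \<in> (R \<inter> W \<times> W)\<^sup>*" by (simp add: comp_in_iff conn_in_def)
  then show "y \<in> V" by (cases rule: rtranclE) (use assms in blast)+
qed

lemma infinite_comp_in_image:
  assumes "inj_on f V" "R \<subseteq> V \<times> V" "W \<subseteq> V" "x \<in> V"
  shows "infinite (comp_in (map_prod f f ` R) (f ` W) (f x)) \<longleftrightarrow> infinite (comp_in R W x)"
proof -
  have "inj_on f (comp_in R W x)"
    using assms(1) comp_in_subset_field[OF assms(2,4)] by (rule inj_on_subset)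
  then show ?thesis unfolding comp_in_image[OF assms] by (simp add: finite_image_iff)
qed

lemma conn_in_image_iff:
  assumes "inj_on f V" "R \<subseteq> V \<times> V" "W \<subseteq> V" "x \<in> V" "y \<in> V"
  shows "(f x, f y) \<in> conn_in (map_prod f f ` R) (f ` W) \<longleftrightarrow> (x, y) \<in> conn_in R W"
proof -
  show ?thesis
    using inj_on_image_mem_iff[OF assms(1,5) comp_in_subset_field[OF assms(2,4), of W]]
    unfolding comp_in_image[OF assms(1-4), symmetric] comp_in_iff .
qed

fun gball :: "('v \<times> 'v) set \<Rightarrow> 'v \<Rightarrow> nat \<Rightarrow> 'v set" where
  "gball E x 0 = {x}"
| "gball E x (Suc r) = gball E x r \<union> E `` gball E x r"

lemma gball_self [simp]: "x \<in> gball E x r"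
  by (induction r) auto

lemma gball_mono: "r \<le> s \<Longrightarrow> gball E x r \<subseteq> gball E x s"
  by (induction s) (auto simp: le_Suc_eq)

lemma gball_trans: "y \<in> gball E x r \<Longrightarrow> z \<in> gball E y s \<Longrightarrow> z \<in> gball E x (r + s)"
  by (induction s arbitrary: z) auto

lemma gball_sym:
  assumes "sym E"
  shows "y \<in> gball E x r \<Longrightarrow> x \<in> gball E y r"
proof (induction r arbitrary: y)
  case (Suc r)
  then consider "y \<in> gball E x r" | z where "z \<in> gball E x r" "(z, y) \<in> E" by auto
  then show ?case
  proof cases
    case 2
    then have "z \<in> gball E y 1" using assms by (auto dest: symD)
    with Suc.IH[OF 2(1)] show ?thesis using gball_trans[of z E y 1 x r] by simp
  qed (use Suc in auto)
qed auto

lemma rtrancl_gball: "(x, y) \<in> E\<^sup>* \<Longrightarrow> \<exists>r. y \<in> gball E x r"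
proof (induction rule: rtrancl_induct)
  case base
  show ?case by (intro exI[of _ 0]) auto
next
  case (step y z)
  then obtain r where "y \<in> gball E x r" by blast
  with step(2) have "z \<in> gball E x (Suc r)" by auto
  then show ?case by blast
qed

text \<open>At the radius where \<open>y\<close> enters the ball it has a neighbour that was already
  inside. The pair of conditions on \<open>k\<close> says that \<open>a\<close> is strictly closer
  to the centre, without introducing a distance.\<close>

lemma gball_parent:
  "y \<in> gball E x r \<Longrightarrow> y \<noteq> x \<Longrightarrow> \<exists>k a. y \<notin> gball E x k \<and> a \<in> gball E x k \<and> (a, y) \<in> E"
proof (induction r)
  case (Suc r)
  show ?case
  proof (cases "y \<in> gball E x r")
    case False
    with Suc.prems obtain a where "a \<in> gball E x r" "(a, y) \<in> E" by auto
    with False show ?thesis by blast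
  qed (use Suc in blast)
qed auto

locale vt_graph =
  fixes V :: "'v set" and E :: "('v \<times> 'v) set" and d :: nat
  assumes countable_V: "countable V" and infinite_V: "infinite V"
    and simple: "simple_digraph V E" and regular: "regular_graph V E d"
    and connected: "connected_graph V E" and transitive: "vertex_transitive V E"
begin

lemma E_sub: "E \<subseteq> V \<times> V" and E_sym: "sym E"
  using simple by (auto simp: simple_digraph_def)

lemma E_V: "(x, y) \<in> E \<Longrightarrow> x \<in> V \<and> y \<in> V"
  using E_sub by auto

lemma E_commute: "(x, y) \<in> E \<Longrightarrow> (y, x) \<in> E"
  using E_sym by (rule symD)

lemma finite_nbrs: "finite (nbrs E x)"
proof (cases "x \<in> V")
  case False
  then have "nbrs E x = {}" using E_sub by (auto simp: nbrs_def)
  then show ?thesis by simp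
qed (use regular in \<open>simp add: regular_graph_def\<close>)

lemma card_nbrs: "x \<in> V \<Longrightarrow> card (nbrs E x) = d"
  using regular by (simp add: regular_graph_def)

lemma nbrs_sub: "nbrs E x \<subseteq> V"
  using E_sub by (auto simp: nbrs_def)

lemma gball_V: "x \<in> V \<Longrightarrow> gball E x r \<subseteq> V"
  using E_sub by (induction r) auto

lemma gball_Suc_UN: "gball E x (Suc r) = gball E x r \<union> (\<Union>y\<in>gball E x r. nbrs E y)"
  by (auto simp: nbrs_def)

lemma finite_gball: "finite (gball E x r)"
proof (induction r)
  case (Suc r)
  then show ?case unfolding gball_Suc_UN by (auto simp: finite_nbrs)
qed simp

lemma card_gball: "x \<in> V \<Longrightarrow> card (gball E x r) \<le> (d + 1) ^ r"
proof (induction r)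
  case (Suc r)
  have "card (\<Union>y\<in>gball E x r. nbrs E y) \<le> (\<Sum>y\<in>gball E x r. card (nbrs E y))"
    by (rule card_UN_le[OF finite_gball])
  also have "\<dots> = (\<Sum>y\<in>gball E x r. d)"
    using subsetD[OF gball_V[OF Suc.prems]] by (intro sum.cong refl card_nbrs)
  finally have "card (gball E x (Suc r)) \<le> card (gball E x r) + card (gball E x r) * d"
    unfolding gball_Suc_UN using card_Un_le[of "gball E x r" "\<Union>y\<in>gball E x r. nbrs E y"] by simp
  also have "\<dots> = card (gball E x r) * (d + 1)" by simp
  also have "\<dots> \<le> (d + 1) ^ r * (d + 1)" using Suc by (intro mult_le_mono1) simp
  finally show ?case by (simp add: mult.commute)
qed simp

lemma gball_exhausts: "x \<in> V \<Longrightarrow> y \<in> V \<Longrightarrow> \<exists>r. y \<in> gball E x r"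
  using connected rtrancl_gball by (fastforce simp: connected_graph_def)

lemma finite_sub_gball:
  assumes "x \<in> V" "finite S" "S \<subseteq> V"
  shows "\<exists>r. S \<subseteq> gball E x r"
  using assms(2,3)
proof (induction S)
  case (insert y S)
  then obtain r s where "S \<subseteq> gball E x r" "y \<in> gball E x s" using gball_exhausts[OF assms(1)] by blast
  then have "insert y S \<subseteq> gball E x (max r s)"
    using gball_mono[of r "max r s" E x] gball_mono[of s "max r s" E x] by auto
  then show ?case by blast
qed simp

lemma ex_edge: "x \<in> V \<Longrightarrow> \<exists>y. (x, y) \<in> E"
proof (rule ccontr)
  assume x: "x \<in> V" "\<nexists>y. (x, y) \<in> E"
  have "V \<subseteq> {x}"
  proof
    fix y assume "y \<in> V"
    with x connected have "(x, y) \<in> E\<^sup>*" by (auto simp: connected_graph_def)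
    then show "y \<in> {x}" using x(2) by (auto elim: converse_rtranclE)
  qed
  then show False using infinite_V finite_subset by auto
qed

text \<open>With at most one neighbour per vertex, a single edge would be a whole component, so
  \<open>V\<close> would be finite. Degree 2 guarantees that every vertex has a state of size 2,
  also with one of its elements prescribed.\<close>

lemma d_ge_2: "d \<ge> 2"
proof (rule ccontr)
  assume "\<not> d \<ge> 2"
  then have uniq: "y = z" if "(x, y) \<in> E" "(x, z) \<in> E" for x y z
    using that card_nbrs[of x] finite_nbrs[of x] E_V card_le_Suc0_iff_eq[of "nbrs E x"]
    by (force simp: nbrs_def)
  obtain x where x: "x \<in> V" using infinite_V by fastforce
  then obtain y where y: "(x, y) \<in> E" using ex_edge by blast
  have "z \<in> {x, y}" if "(x, z) \<in> E\<^sup>*" for z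
    using that
  proof (induction rule: rtrancl_induct)
    case (step z w)
    then show ?case using uniq y E_commute by blast
  qed simp
  then have "V \<subseteq> {x, y}" using x connected by (auto simp: connected_graph_def)
  then show False using infinite_V finite_subset by auto
qed

lemma other_nbr:
  assumes "x \<in> V"
  obtains z where "(x, z) \<in> E" "z \<noteq> y"
proof -
  have "\<not> nbrs E x \<subseteq> {y}"
    using card_mono[of "{y}" "nbrs E x"] card_nbrs[OF assms] d_ge_2 by auto
  then show ?thesis using that by (auto simp: nbrs_def)
qed

abbreviation aut :: "('v \<Rightarrow> 'v) \<Rightarrow> bool" where "aut \<equiv> graph_automorphism V E"

lemma aut_bij: "aut f \<Longrightarrow> bij_betw f V V"
  by (simp add: graph_automorphism_def)

lemma aut_inj: "aut f \<Longrightarrow> inj_on f V"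
  using aut_bij bij_betw_imp_inj_on by blast

lemma aut_V: "aut f \<Longrightarrow> x \<in> V \<Longrightarrow> f x \<in> V"
  using aut_bij bij_betwE by blast

lemma aut_image: "aut f \<Longrightarrow> f ` V = V"
  using aut_bij bij_betw_imp_surj_on by blast

lemma aut_E: "aut f \<Longrightarrow> x \<in> V \<Longrightarrow> y \<in> V \<Longrightarrow> (f x, f y) \<in> E \<longleftrightarrow> (x, y) \<in> E"
  by (simp add: graph_automorphism_def)

lemma aut_inv_l: "aut f \<Longrightarrow> x \<in> V \<Longrightarrow> inv_into V f (f x) = x"
  by (simp add: aut_inj)

lemma aut_inv_r: "aut f \<Longrightarrow> x \<in> V \<Longrightarrow> f (inv_into V f x) = x"
  by (rule bij_betw_inv_into_right[OF aut_bij])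

lemma aut_inv_V: "aut f \<Longrightarrow> x \<in> V \<Longrightarrow> inv_into V f x \<in> V"
  by (rule bij_betwE[OF bij_betw_inv_into[OF aut_bij], rule_format])

lemma aut_inv_into:
  assumes "aut f"
  shows "aut (inv_into V f)"
  unfolding graph_automorphism_def
proof (intro conjI ballI)
  show "bij_betw (inv_into V f) V V" using assms by (intro bij_betw_inv_into aut_bij)
  fix x y assume "x \<in> V" "y \<in> V"
  then show "(x, y) \<in> E \<longleftrightarrow> (inv_into V f x, inv_into V f y) \<in> E"
    using aut_E[OF assms, of "inv_into V f x" "inv_into V f y"] assms
    by (simp add: aut_inv_V aut_inv_r)
qed

lemma aut_nbrs:
  assumes "aut f" "x \<in> V"
  shows "f ` nbrs E x = nbrs E (f x)"
proof (intro equalityI subsetI)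
  fix z assume "z \<in> f ` nbrs E x"
  then obtain y where "(x, y) \<in> E" "z = f y" by (auto simp: nbrs_def)
  then show "z \<in> nbrs E (f x)" using aut_E[OF assms] E_V by (auto simp: nbrs_def)
next
  fix z assume z: "z \<in> nbrs E (f x)"
  then have zV: "z \<in> V" using nbrs_sub by blast
  let ?y = "inv_into V f z"
  have fy: "f ?y = z" using aut_inv_r[OF assms(1) zV] .
  have "(f x, f ?y) \<in> E" using z unfolding fy by (simp add: nbrs_def)
  then have "?y \<in> nbrs E x"
    using aut_E[OF assms aut_inv_V[OF assms(1) zV]] by (simp add: nbrs_def)
  then show "z \<in> f ` nbrs E x" using fy by (metis imageI)
qed

lemma aut_gball: "aut f \<Longrightarrow> x \<in> V \<Longrightarrow> y \<in> gball E x r \<Longrightarrow> f y \<in> gball E (f x) r"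
proof (induction r arbitrary: y)
  case (Suc r)
  then consider "y \<in> gball E x r" | z where "z \<in> gball E x r" "(z, y) \<in> E" by auto
  then show ?case
  proof cases
    case 2
    then have "(f z, f y) \<in> E" using aut_E[OF Suc.prems(1)] E_V by blast
    with Suc.IH[OF Suc.prems(1,2) 2(1)] show ?thesis by auto
  qed (use Suc in auto)
qed simp

lemma aut_image_gball:
  assumes "aut f" "x \<in> V"
  shows "f ` gball E x r = gball E (f x) r"
proof (intro equalityI subsetI)
  fix z assume z: "z \<in> gball E (f x) r"
  then have "z \<in> V" using gball_V aut_V assms by blast
  moreover have "inv_into V f z \<in> gball E x r"
    using aut_gball[OF aut_inv_into[OF assms(1)] aut_V[OF assms] z] by (simp add: aut_inv_l assms)
  ultimately show "z \<in> f ` gball E x r" using aut_inv_r[OF assms(1)] by (metis imageI)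
qed (use aut_gball assms in blast)

lemma ex_aut_disjoint:
  assumes "finite J" "J \<subseteq> V"
  obtains f where "aut f" "f ` J \<inter> J = {}"
proof -
  obtain x where x: "x \<in> V" using infinite_V by fastforce
  obtain r where r: "J \<subseteq> gball E x r" using finite_sub_gball[OF x] assms by blast
  \<comment> \<open>Beyond radius \<open>r + r\<close> the balls of radius \<open>r\<close> about
    \<open>x\<close> and \<open>y\<close> are disjoint.\<close>
  obtain y where y: "y \<in> V" "y \<notin> gball E x (r + r)"
    using infinite_V finite_gball[of x "r + r"] by (meson finite_subset subsetI)
  obtain f where f: "aut f" "f x = y" using transitive x y by (auto simp: vertex_transitive_def)
  have "f ` J \<inter> J = {}"
  proof (rule ccontr)
    assume "f ` J \<inter> J \<noteq> {}"
    then obtain j where j: "j \<in> J" "f j \<in> J" by blast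
    then have "f j \<in> gball E y r" "f j \<in> gball E x r" using aut_gball[OF f(1) x] r f(2) by blast+
    then show False using y gball_trans[of "f j" E x r y r] gball_sym[OF E_sym] by blast
  qed
  with f show ?thesis using that by blast
qed

end

section \<open>Configurations as undirected graphs and their product measure\<close>

definition und :: "'v set \<Rightarrow> ('v \<Rightarrow> 'v set) \<Rightarrow> ('v \<times> 'v) set" where
  "und V \<omega> = config_arcs V \<omega> \<union> (config_arcs V \<omega>)\<inverse>"

lemma und_iff: "(x, y) \<in> und V \<omega> \<longleftrightarrow> x \<in> V \<and> y \<in> \<omega> x \<or> y \<in> V \<and> x \<in> \<omega> y"
  by (auto simp: und_def config_arcs_def)

lemma sym_und: "sym (und V \<omega>)"
  by (auto simp: sym_def und_iff)

locale percolation = vt_graph V E d for V :: "'v set" and E d +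
  fixes p :: "nat \<Rightarrow> real"
  assumes prob_vec: "prob_vector d p"
begin

abbreviation P :: "('v \<Rightarrow> 'v set) measure" where "P \<equiv> config_measure V E d p"
abbreviation \<mu> :: "'v \<Rightarrow> 'v set measure" where "\<mu> \<equiv> state_measure E d p"

lemma space_\<mu>: "space (\<mu> x) = Pow (nbrs E x)"
  and sets_\<mu>: "sets (\<mu> x) = Pow (Pow (nbrs E x))"
  by (simp_all add: state_measure_def space_point_measure sets_point_measure)

lemma emeasure_\<mu>:
  "X \<subseteq> Pow (nbrs E x) \<Longrightarrow> emeasure (\<mu> x) X = (\<Sum>S\<in>X. ennreal (p (card S) / real (d choose card S)))"
  unfolding state_measure_def using finite_nbrs by (intro emeasure_point_measure_finite) auto

lemma prob_space_\<mu>: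
  assumes "x \<in> V"
  shows "prob_space (\<mu> x)"
proof
  let ?N = "nbrs E x" and ?g = "\<lambda>k. p k / real (d choose k)"
  have N: "finite ?N" "card ?N = d" using assms finite_nbrs card_nbrs by auto
  have card: "card S \<le> d" if "S \<subseteq> ?N" for S using that N card_mono by blast
  have nonneg: "0 \<le> ?g (card S)" if "S \<subseteq> ?N" for S
    using prob_vec card[OF that] by (simp add: prob_vector_def)
  \<comment> \<open>Grouping states by size makes the binomial coefficients cancel.\<close>
  have "(\<Sum>S\<in>Pow ?N. ?g (card S)) = (\<Sum>k\<le>d. \<Sum>S\<in>{S\<in>Pow ?N. card S = k}. ?g (card S))"
    using N card by (intro sum.group[symmetric]) auto
  also have "\<dots> = (\<Sum>k\<le>d. real (d choose k) * ?g k)"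
  proof (intro sum.cong refl)
    fix k
    have "(\<Sum>S\<in>{S\<in>Pow ?N. card S = k}. ?g (card S)) = (\<Sum>S\<in>{S\<in>Pow ?N. card S = k}. ?g k)"
      by (intro sum.cong) auto
    then show "(\<Sum>S\<in>{S\<in>Pow ?N. card S = k}. ?g (card S)) = real (d choose k) * ?g k"
      using n_subsets[OF N(1), of k] N by simp
  qed
  also have "\<dots> = (\<Sum>k\<le>d. p k)" by (intro sum.cong) auto
  also have "\<dots> = 1" using prob_vec by (simp add: prob_vector_def)
  finally have "(\<Sum>S\<in>Pow ?N. ennreal (?g (card S))) = 1"
    using nonneg by (subst sum_ennreal) auto
  then show "emeasure (\<mu> x) (space (\<mu> x)) = 1" by (simp add: space_\<mu> emeasure_\<mu>)
qed

lemma P_def: "P = PiM V \<mu>"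
  by (simp add: config_measure_def)

lemma space_P: "space P = (\<Pi>\<^sub>E x\<in>V. Pow (nbrs E x))"
  by (simp add: P_def space_PiM space_\<mu>)

sublocale prob_space P
  unfolding P_def by (intro prob_space_PiM prob_space_\<mu>)

lemma state_sub: "\<omega> \<in> space P \<Longrightarrow> x \<in> V \<Longrightarrow> \<omega> x \<subseteq> nbrs E x"
  by (auto simp: space_P PiE_iff)

lemma und_sub_E:
  assumes "\<omega> \<in> space P"
  shows "und V \<omega> \<subseteq> E"
  using state_sub[OF assms] E_commute by (force simp: und_iff nbrs_def)

lemma und_sub_V: "\<omega> \<in> space P \<Longrightarrow> und V \<omega> \<subseteq> V \<times> V"
  using und_sub_E E_sub by blast

lemma finite_und:
  assumes "\<omega> \<in> space P"
  shows "finite (und V \<omega> `` {x})"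
proof (rule finite_subset[OF _ finite_nbrs[of x]])
  show "und V \<omega> `` {x} \<subseteq> nbrs E x" using und_sub_E[OF assms] by (auto simp: nbrs_def)
qed

subsection \<open>Measurability\<close>

lemma measurable_state: "x \<in> V \<Longrightarrow> Measurable.pred P (\<lambda>\<omega>. y \<in> \<omega> x)"
proof -
  assume x: "x \<in> V"
  have "(\<lambda>\<omega>. \<omega> x) \<in> measurable P (\<mu> x)" unfolding P_def using x by (rule measurable_component_singleton)
  moreover have "{S \<in> space (\<mu> x). y \<in> S} \<in> sets (\<mu> x)" by (auto simp: sets_\<mu> space_\<mu>)
  ultimately have "(\<lambda>\<omega>. \<omega> x) -` {S \<in> space (\<mu> x). y \<in> S} \<inter> space P \<in> sets P" by (rule measurable_sets)
  moreover have "(\<lambda>\<omega>. \<omega> x) -` {S \<in> space (\<mu> x). y \<in> S} \<inter> space P = {\<omega> \<in> space P. y \<in> \<omega> x}"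
    using x by (auto simp: space_\<mu> space_P)
  ultimately show ?thesis by (simp add: pred_def)
qed

lemma measurable_und:
  assumes "x \<in> V" "y \<in> V"
  shows "Measurable.pred P (\<lambda>\<omega>. (x, y) \<in> und V \<omega>)"
  unfolding und_iff using assms by (intro pred_intros_logic measurable_state) auto

lemma measurable_conn_in:
  assumes "W \<subseteq> V"
  shows "Measurable.pred P (\<lambda>\<omega>. (x, y) \<in> conn_in (und V \<omega>) W)"
proof -
  have "Measurable.pred P (\<lambda>\<omega>. (x, y) \<in> (und V \<omega> \<inter> W \<times> W) ^^ n)" for n
  proof (induction n arbitrary: y)
    case (Suc n)
    have eq: "(x, y) \<in> (und V \<omega> \<inter> W \<times> W) ^^ Suc n \<longleftrightarrow>
      (\<exists>z\<in>W. (x, z) \<in> (und V \<omega> \<inter> W \<times> W) ^^ n \<and> (z, y) \<in> und V \<omega> \<and> y \<in> W)" for \<omega>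
      by (auto simp: relcomp_unfold)
    show ?case
    proof (cases "y \<in> W")
      case True
      then show ?thesis unfolding eq using assms countable_subset[OF assms countable_V]
        by (intro measurable_pred_countable pred_intros_logic Suc measurable_und) auto
    next
      case False
      then show ?thesis unfolding eq by simp
    qed
  qed simp
  then show ?thesis unfolding conn_in_def rtrancl_power by (intro pred_intros_countable)
qed

text \<open>A subset of \<open>V\<close> is infinite iff it escapes every finite subset of
  \<open>V\<close>, and a countable set has only countably many finite subsets.\<close>

lemma measurable_infinite_comp_in:
  assumes "W \<subseteq> V" "x \<in> V"
  shows "Measurable.pred P (\<lambda>\<omega>. infinite (comp_in (und V \<omega>) W x))"
proof -
  have "infinite (comp_in (und V \<omega>) W x) \<longleftrightarrow>
      (\<forall>F\<in>{F. finite F \<and> F \<subseteq> V}. \<exists>y\<in>V - F. (x, y) \<in> conn_in (und V \<omega>) W)"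
    if "\<omega> \<in> space P" for \<omega>
  proof -
    have sub: "comp_in (und V \<omega>) W x \<subseteq> V"
      using und_sub_V[OF that] assms(2) by (rule comp_in_subset_field)
    show ?thesis
    proof
      assume inf: "infinite (comp_in (und V \<omega>) W x)"
      show "\<forall>F\<in>{F. finite F \<and> F \<subseteq> V}. \<exists>y\<in>V - F. (x, y) \<in> conn_in (und V \<omega>) W"
      proof
        fix F assume "F \<in> {F. finite F \<and> F \<subseteq> V}"
        then have "\<not> comp_in (und V \<omega>) W x \<subseteq> F" using inf finite_subset by auto
        then show "\<exists>y\<in>V - F. (x, y) \<in> conn_in (und V \<omega>) W" using sub by (auto simp: comp_in_iff)
      qed
    next
      assume "\<forall>F\<in>{F. finite F \<and> F \<subseteq> V}. \<exists>y\<in>V - F. (x, y) \<in> conn_in (und V \<omega>) W"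
      with sub show "infinite (comp_in (und V \<omega>) W x)" by (auto simp: comp_in_iff[symmetric])
    qed
  qed
  moreover have "Measurable.pred P
      (\<lambda>\<omega>. \<forall>F\<in>{F. finite F \<and> F \<subseteq> V}. \<exists>y\<in>V - F. (x, y) \<in> conn_in (und V \<omega>) W)"
    using countable_Collect_finite_subset[OF countable_V] countable_V assms
    by (intro measurable_pred_countable measurable_conn_in) auto
  ultimately show ?thesis by (simp cong: measurable_cong)
qed

subsection \<open>Finite energy\<close>

definition allowed :: "'v \<Rightarrow> 'v set \<Rightarrow> bool" where
  "allowed x S \<longleftrightarrow> S \<subseteq> nbrs E x \<and> 0 < p (card S)"

lemma upd_space: "\<omega> \<in> space P \<Longrightarrow> x \<in> V \<Longrightarrow> S \<subseteq> nbrs E x \<Longrightarrow> \<omega> (x := S) \<in> space P"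
  by (auto simp: space_P PiE_iff extensional_def)

text \<open>Resampling the state of \<open>x\<close> independently leaves \<open>P\<close>
  unchanged, so by Fubini the property holds for almost every new state. Allowed states are atoms of
  positive weight and hence cannot be exceptional. The quantifiers over \<open>x\<close> and
  \<open>S\<close> are countable and go inside.\<close>

lemma AE_upd:
  assumes "AE \<omega> in P. Q \<omega>"
  shows "AE \<omega> in P. \<forall>x\<in>V. \<forall>S. allowed x S \<longrightarrow> Q (\<omega> (x := S))"
proof -
  have "AE \<omega> in P. \<forall>S\<in>Pow (nbrs E x). allowed x S \<longrightarrow> Q (\<omega> (x := S))" if x: "x \<in> V" for x
  proof -
    interpret M: prob_space "\<mu> x" using x by (rule prob_space_\<mu>)
    interpret pair_prob_space "\<mu> x" P ..
    have ins: "insert x V = V" using x by auto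
    have *: "distr (\<mu> x \<Otimes>\<^sub>M P) P (\<lambda>(s, \<omega>). \<omega> (x := s)) = P"
      using distr_pair_PiM_eq_PiM[of V \<mu> x] prob_space_\<mu> x unfolding P_def ins by auto
    have m: "(\<lambda>(s, \<omega>). \<omega> (x := s)) \<in> measurable (\<mu> x \<Otimes>\<^sub>M P) P"
      unfolding split_beta P_def using x
      by (intro measurable_fun_upd[where J=V] measurable_fst measurable_snd) auto
    have "AE w in \<mu> x \<Otimes>\<^sub>M P. Q ((\<lambda>(s, \<omega>). \<omega> (x := s)) w)"
      by (rule AE_distrD[OF m, unfolded *, OF assms])
    then have "AE s in \<mu> x. AE \<omega> in P. Q (\<omega> (x := s))" using AE_pair by fastforce
    then have "\<forall>S\<in>Pow (nbrs E x). 0 < ennreal (p (card S) / real (d choose card S)) \<longrightarrow>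
        (AE \<omega> in P. Q (\<omega> (x := S)))"
      unfolding state_measure_def AE_point_measure .
    \<comment> \<open>For \<open>card S > d\<close> the binomial coefficient would be 0 and, by
      division by 0, so would the weight; \<open>S \<subseteq> nbrs E x\<close> excludes
      this.\<close>
    moreover have "0 < ennreal (p (card S) / real (d choose card S))" if "allowed x S" for S
    proof -
      have "card S \<le> d" using that x finite_nbrs card_nbrs card_mono by (metis allowed_def)
      then show ?thesis using that by (simp add: allowed_def)
    qed
    ultimately have "AE \<omega> in P. allowed x S \<longrightarrow> Q (\<omega> (x := S))" if "S \<in> Pow (nbrs E x)" for S
      using that by (cases "allowed x S") auto
    then show ?thesis using finite_nbrs by (intro AE_finite_allI) auto
  qed
  then have "AE \<omega> in P. \<forall>x\<in>V. \<forall>S\<in>Pow (nbrs E x). allowed x S \<longrightarrow> Q (\<omega> (x := S))"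
    using countable_V by (subst AE_ball_countable) auto
  then show ?thesis by (rule AE_mp) (auto simp: allowed_def)
qed

definition mod_closed :: "('v \<Rightarrow> 'v set) set \<Rightarrow> bool" where
  "mod_closed R \<longleftrightarrow> R \<subseteq> space P \<and> (\<forall>\<omega>\<in>R. \<forall>x\<in>V. \<forall>S. allowed x S \<longrightarrow> \<omega> (x := S) \<in> R)"

lemma mod_closed_upd: "mod_closed R \<Longrightarrow> \<omega> \<in> R \<Longrightarrow> x \<in> V \<Longrightarrow> allowed x S \<Longrightarrow> \<omega> (x := S) \<in> R"
  by (simp add: mod_closed_def)

lemma mod_closed_space: "mod_closed R \<Longrightarrow> \<omega> \<in> R \<Longrightarrow> \<omega> \<in> space P"
  by (auto simp: mod_closed_def)

lemma mod_closed_override: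
  assumes "mod_closed R" "\<omega> \<in> R" "finite B" "B \<subseteq> V" "\<And>x. x \<in> B \<Longrightarrow> allowed x (\<sigma> x)"
  shows "(\<lambda>x. if x \<in> B then \<sigma> x else \<omega> x) \<in> R"
  using assms(3-)
proof (induction B)
  case (insert x B)
  have "(\<lambda>y. if y \<in> insert x B then \<sigma> y else \<omega> y) = (\<lambda>y. if y \<in> B then \<sigma> y else \<omega> y)(x := \<sigma> x)"
    by (rule ext) simp
  then show ?case using insert assms(1) by (auto intro!: mod_closed_upd)
qed (use assms in simp)

text \<open>The \<open>n\<close>-th iterate of \<open>step\<close> demands \<open>Q\<close> after
  every sequence of at most \<open>n\<close> allowed changes. By \<open>AE_upd\<close> each iterate
  is almost sure, hence so are all together, and the configurations satisfying all of them are
  closed under allowed changes.\<close>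

lemma AE_mod_closed:
  assumes "AE \<omega> in P. Q \<omega>"
  obtains R where "mod_closed R" "R \<noteq> {}" "\<And>\<omega>. \<omega> \<in> R \<Longrightarrow> Q \<omega>"
proof -
  define step where "step = (\<lambda>Q \<omega>. Q \<omega> \<and> (\<forall>x\<in>V. \<forall>S. allowed x S \<longrightarrow> Q (\<omega> (x := S))))"
  have step_iff: "step Q' \<omega> \<longleftrightarrow> Q' \<omega> \<and> (\<forall>x\<in>V. \<forall>S. allowed x S \<longrightarrow> Q' (\<omega> (x := S)))" for Q' \<omega>
    unfolding step_def ..
  have "AE \<omega> in P. (step ^^ n) Q \<omega>" for n
  proof (induction n)
    case (Suc n)
    from Suc AE_upd[OF Suc] have "AE \<omega> in P. step ((step ^^ n) Q) \<omega>"
      unfolding step_iff by (rule AE_conjI)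
    then show ?case unfolding funpow.simps o_def .
  qed (use assms in simp)
  then have "AE \<omega> in P. \<forall>n. (step ^^ n) Q \<omega>" unfolding AE_all_countable by blast
  \<comment> \<open>The set of these configurations is not claimed to be measurable; a measurable
    subset of probability 1 suffices to find an element.\<close>
  then obtain T where T: "T \<subseteq> {\<omega> \<in> space P. \<forall>n. (step ^^ n) Q \<omega>}" "prob T = 1"
    by (rule AE_E_prob)
  have "T \<noteq> {}" using T(2) by auto
  with T(1) have "\<exists>\<omega>\<in>space P. \<forall>n. (step ^^ n) Q \<omega>" by blast
  moreover have "mod_closed {\<omega> \<in> space P. \<forall>n. (step ^^ n) Q \<omega>}"
    unfolding mod_closed_def
  proof (intro conjI ballI allI impI)
    fix \<omega> x S assume *: "\<omega> \<in> {\<omega> \<in> space P. \<forall>n. (step ^^ n) Q \<omega>}" "x \<in> V" "allowed x S"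
    then have "(step ^^ n) Q (\<omega> (x := S))" for n
    proof -
      have "(step ^^ Suc n) Q \<omega>" using * by blast
      with *(2,3) show ?thesis unfolding funpow.simps o_def step_iff by blast
    qed
    with * show "\<omega> (x := S) \<in> {\<omega> \<in> space P. \<forall>n. (step ^^ n) Q \<omega>}"
      by (auto intro: upd_space simp: allowed_def)
  qed blast
  moreover have "Q \<omega>" if "\<forall>n. (step ^^ n) Q \<omega>" for \<omega>
    using that[rule_format, of 0] by simp
  ultimately show ?thesis using that[of "{\<omega> \<in> space P. \<forall>n. (step ^^ n) Q \<omega>}"] by blast
qed
subsection \<open>Invariance and ergodicity\<close>

text \<open>The pushforward of a configuration: the state at \<open>f x\<close> is the image of the
  state at \<open>x\<close>. The restriction to \<open>V\<close> keeps the result in the extensional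
  product space.\<close>

definition act :: "('v \<Rightarrow> 'v) \<Rightarrow> ('v \<Rightarrow> 'v set) \<Rightarrow> 'v \<Rightarrow> 'v set" where
  "act f \<omega> = (\<lambda>x\<in>V. f ` \<omega> (inv_into V f x))"

lemma act_space:
  assumes "aut f" "\<omega> \<in> space P"
  shows "act f \<omega> \<in> space P"
proof -
  have "f ` \<omega> (inv_into V f x) \<subseteq> nbrs E x" if "x \<in> V" for x
  proof -
    have "\<omega> (inv_into V f x) \<subseteq> nbrs E (inv_into V f x)"
      using assms that by (intro state_sub aut_inv_V)
    then have "f ` \<omega> (inv_into V f x) \<subseteq> f ` nbrs E (inv_into V f x)" by blast
    also have "\<dots> = nbrs E x"
      using aut_nbrs[OF assms(1) aut_inv_V[OF assms(1) that]] aut_inv_r[OF assms(1) that] by simp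
    finally show ?thesis .
  qed
  then show ?thesis by (auto simp: space_P act_def)
qed

lemma und_act:
  assumes "aut f" "\<omega> \<in> space P"
  shows "und V (act f \<omega>) = map_prod f f ` und V \<omega>"
proof -
  have "config_arcs V (act f \<omega>) = map_prod f f ` config_arcs V \<omega>"
  proof (intro equalityI subrelI)
    fix x y assume "(x, y) \<in> config_arcs V (act f \<omega>)"
    then have x: "x \<in> V" "y \<in> f ` \<omega> (inv_into V f x)" by (auto simp: config_arcs_def act_def)
    then obtain z where z: "z \<in> \<omega> (inv_into V f x)" "y = f z" by blast
    have "(inv_into V f x, z) \<in> config_arcs V \<omega>"
      using z aut_inv_V[OF assms(1) x(1)] by (simp add: config_arcs_def)
    moreover have "(x, y) = map_prod f f (inv_into V f x, z)"
      using z(2) aut_inv_r[OF assms(1) x(1)] by simp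
    ultimately show "(x, y) \<in> map_prod f f ` config_arcs V \<omega>" by blast
  next
    fix x y assume "(x, y) \<in> map_prod f f ` config_arcs V \<omega>"
    then obtain a b where ab: "a \<in> V" "b \<in> \<omega> a" "x = f a" "y = f b" by (auto simp: config_arcs_def)
    then show "(x, y) \<in> config_arcs V (act f \<omega>)"
      using aut_V[OF assms(1)] aut_inv_l[OF assms(1)] by (auto simp: config_arcs_def act_def)
  qed
  then show ?thesis unfolding und_def by (force simp: image_Un)
qed

lemma infinite_comp_in_act:
  assumes "aut f" "\<omega> \<in> space P" "W \<subseteq> V" "x \<in> V"
  shows "infinite (comp_in (und V (act f \<omega>)) (f ` W) (f x)) \<longleftrightarrow> infinite (comp_in (und V \<omega>) W x)"
  unfolding und_act[OF assms(1,2)]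
  by (rule infinite_comp_in_image[OF aut_inj[OF assms(1)] und_sub_V[OF assms(2)] assms(3,4)])

lemma conn_in_act:
  assumes "aut f" "\<omega> \<in> space P" "W \<subseteq> V" "x \<in> V" "y \<in> V"
  shows "(f x, f y) \<in> conn_in (und V (act f \<omega>)) (f ` W) \<longleftrightarrow> (x, y) \<in> conn_in (und V \<omega>) W"
  unfolding und_act[OF assms(1,2)]
  by (rule conn_in_image_iff[OF aut_inj[OF assms(1)] und_sub_V[OF assms(2)] assms(3-5)])

lemma act_measurable:
  assumes "aut f"
  shows "act f \<in> measurable P P"
  unfolding P_def
proof (rule measurable_PiM_single)
  show "act f \<in> space (Pi\<^sub>M V \<mu>) \<rightarrow> (\<Pi>\<^sub>E i\<in>V. space (\<mu> i))"
    using act_space[OF assms] unfolding P_def space_PiM by blast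
  fix A i assume i: "A \<in> sets (\<mu> i)" "i \<in> V"
  let ?j = "inv_into V f i"
  have j: "?j \<in> V" using i assms aut_inv_V by blast
  have "{\<omega> \<in> space (Pi\<^sub>M V \<mu>). act f \<omega> i \<in> A} =
      (\<lambda>\<omega>. \<omega> ?j) -` {S \<in> space (\<mu> ?j). f ` S \<in> A} \<inter> space (Pi\<^sub>M V \<mu>)"
    using i j by (auto simp: act_def space_PiM dest: PiE_mem)
  also have "\<dots> \<in> sets (Pi\<^sub>M V \<mu>)"
    by (rule measurable_sets[OF measurable_component_singleton[OF j]]) (auto simp: sets_\<mu> space_\<mu>)
  finally show "{\<omega> \<in> space (Pi\<^sub>M V \<mu>). act f \<omega> i \<in> A} \<in> sets (Pi\<^sub>M V \<mu>)" .
qed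

text \<open>The weight of a state depends only on its size, which an injective image
  preserves.\<close>

lemma emeasure_\<mu>_aut:
  assumes "aut f" "x \<in> V" "A \<in> sets (\<mu> (f x))"
  shows "emeasure (\<mu> x) {S \<in> space (\<mu> x). f ` S \<in> A} = emeasure (\<mu> (f x)) A"
proof -
  let ?g = "\<lambda>S :: 'v set. ennreal (p (card S) / real (d choose card S))"
  let ?X = "{S \<in> space (\<mu> x). f ` S \<in> A}"
  have inj: "inj_on f (nbrs E x)" using aut_inj[OF assms(1)] nbrs_sub by (rule inj_on_subset)
  have im: "(\<lambda>S. f ` S) ` ?X = A"
  proof (intro equalityI subsetI)
    fix T assume T: "T \<in> A"
    then have "T \<subseteq> f ` nbrs E x" using assms by (auto simp: sets_\<mu> aut_nbrs)
    then obtain S where "S \<subseteq> nbrs E x" "T = f ` S" by (auto simp: subset_image_iff)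
    with T show "T \<in> (\<lambda>S. f ` S) ` ?X" by (auto simp: space_\<mu>)
  qed auto
  have injX: "inj_on (\<lambda>S. f ` S) ?X"
    using inj_on_image_Pow[OF inj] by (rule inj_on_subset) (auto simp: space_\<mu>)
  have "emeasure (\<mu> (f x)) A = (\<Sum>T\<in>(\<lambda>S. f ` S) ` ?X. ?g T)"
    using assms(3) by (simp add: emeasure_\<mu> im sets_\<mu>)
  also have "\<dots> = (\<Sum>S\<in>?X. ?g (f ` S))" using injX by (simp add: sum.reindex)
  also have "\<dots> = (\<Sum>S\<in>?X. ?g S)"
    using inj by (intro sum.cong refl) (auto simp: space_\<mu> card_image inj_on_subset)
  also have "\<dots> = emeasure (\<mu> x) ?X" by (rule emeasure_\<mu>[symmetric]) (auto simp: space_\<mu>)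
  finally show ?thesis ..
qed

text \<open>On finite cylinders \<open>act f\<close> merely relabels coordinates, and corresponding
  factors have equal weights; cylinders determine the product measure.\<close>

lemma distr_act:
  assumes "aut f"
  shows "distr P P (act f) = P"
proof -
  let ?i = "inv_into V f"
  interpret Q: prob_space "Pi\<^sub>M V \<mu>" by (intro prob_space_PiM prob_space_\<mu>)
  have "Pi\<^sub>M V \<mu> = distr P P (act f)"
  proof (rule measure_eqI_PiM_infinite[OF refl])
    show "finite_measure (Pi\<^sub>M V \<mu>)" by unfold_locales
    show "sets (distr P P (act f)) = sets (Pi\<^sub>M V \<mu>)" by (simp add: P_def)
    fix A J assume J: "finite J" "J \<subseteq> V" and A: "\<And>i. i \<in> J \<Longrightarrow> A i \<in> sets (\<mu> i)"
    define B where "B = (\<lambda>j. {S \<in> space (\<mu> j). f ` S \<in> A (f j)})"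
    have iJ: "?i ` J \<subseteq> V" using aut_inv_V[OF assms] J by blast
    have inj: "inj_on ?i J" using J aut_image[OF assms] by (intro inj_on_inv_into) auto
    have B: "B (?i i) \<in> sets (\<mu> (?i i))" for i by (auto simp: B_def sets_\<mu> space_\<mu>)
    have emb: "prod_emb V \<mu> J (Pi\<^sub>E J A) \<in> sets (Pi\<^sub>M V \<mu>)" using J A by (intro sets_PiM_I) auto
    have "emeasure (distr P P (act f)) (prod_emb V \<mu> J (Pi\<^sub>E J A)) =
        emeasure P (act f -` prod_emb V \<mu> J (Pi\<^sub>E J A) \<inter> space P)"
      using emb by (intro emeasure_distr act_measurable[OF assms]) (simp add: P_def)
    also have "act f -` prod_emb V \<mu> J (Pi\<^sub>E J A) \<inter> space P = prod_emb V \<mu> (?i ` J) (Pi\<^sub>E (?i ` J) B)"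
    proof (intro equalityI subsetI)
      fix \<omega> assume w: "\<omega> \<in> act f -` prod_emb V \<mu> J (Pi\<^sub>E J A) \<inter> space P"
      then have "act f \<omega> j \<in> A j" if "j \<in> J" for j using that by (auto simp: prod_emb_def)
      then have "f ` \<omega> (?i j) \<in> A (f (?i j))" if "j \<in> J" for j
        using that J aut_inv_r[OF assms, of j] by (force simp: act_def)
      then have "\<omega> (?i j) \<in> B (?i j)" if "j \<in> J" for j
        using that w iJ state_sub[of \<omega> "?i j"] by (auto simp: B_def space_\<mu>)
      then show "\<omega> \<in> prod_emb V \<mu> (?i ` J) (Pi\<^sub>E (?i ` J) B)"
        using w by (auto simp: prod_emb_def space_P space_\<mu> PiE_iff)
    next
      fix \<omega> assume w: "\<omega> \<in> prod_emb V \<mu> (?i ` J) (Pi\<^sub>E (?i ` J) B)"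
      then have sp: "\<omega> \<in> space P" by (auto simp: prod_emb_def space_P space_\<mu> PiE_iff)
      have "\<omega> (?i j) \<in> B (?i j)" if "j \<in> J" for j using w that by (auto simp: prod_emb_def PiE_iff)
      then have "f ` \<omega> (?i j) \<in> A j" if "j \<in> J" for j
        using that J aut_inv_r[OF assms, of j] by (force simp: B_def)
      then have "act f \<omega> j \<in> A j" if "j \<in> J" for j using that J by (auto simp: act_def)
      then show "\<omega> \<in> act f -` prod_emb V \<mu> J (Pi\<^sub>E J A) \<inter> space P"
        using sp act_space[OF assms sp] J by (auto simp: prod_emb_def space_P space_\<mu> PiE_iff)
    qed
    also have "emeasure P \<dots> = (\<Prod>j\<in>?i ` J. emeasure (\<mu> j) (B j))"
      unfolding P_def using J iJ B by (intro emeasure_PiM_emb prob_space_\<mu>) auto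
    also have "\<dots> = (\<Prod>i\<in>J. emeasure (\<mu> (?i i)) (B (?i i)))" using inj by (simp add: prod.reindex)
    also have "\<dots> = (\<Prod>i\<in>J. emeasure (\<mu> i) (A i))"
    proof (intro prod.cong refl)
      fix i assume i: "i \<in> J"
      then have iV: "i \<in> V" using J by blast
      show "emeasure (\<mu> (?i i)) (B (?i i)) = emeasure (\<mu> i) (A i)"
        using emeasure_\<mu>_aut[OF assms aut_inv_V[OF assms iV], of "A i"] A[OF i]
        by (simp add: B_def aut_inv_r[OF assms iV])
    qed
    also have "\<dots> = emeasure (Pi\<^sub>M V \<mu>) (prod_emb V \<mu> J (Pi\<^sub>E J A))"
      using J A by (intro emeasure_PiM_emb[symmetric] prob_space_\<mu>) auto
    finally show "emeasure (Pi\<^sub>M V \<mu>) (prod_emb V \<mu> J (Pi\<^sub>E J A)) =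
        emeasure (distr P P (act f)) (prod_emb V \<mu> J (Pi\<^sub>E J A))" ..
  qed
  then show ?thesis by (simp add: P_def)
qed

lemma prob_act:
  assumes "aut f" "A \<in> events"
  shows "prob (act f -` A \<inter> space P) = prob A"
  using measure_distr[OF act_measurable[OF assms(1)] assms(2)] distr_act[OF assms(1)] by simp

section \<open>Local events, approximation and mixing\<close>

definition local_event :: "'v set \<Rightarrow> ('v \<Rightarrow> 'v set) set \<Rightarrow> bool" where
  "local_event J B \<longleftrightarrow> B \<in> events \<and>
     (\<forall>\<omega>\<in>space P. \<forall>\<omega>'\<in>space P. (\<forall>x\<in>J. \<omega> x = \<omega>' x) \<longrightarrow> (\<omega> \<in> B \<longleftrightarrow> \<omega>' \<in> B))"

text \<open>A finite \<open>J\<close> carries only finitely many state patterns, so the set of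
  patterns occurring in \<open>B\<close> is automatically measurable in the finite product. This
  brings local events into the form required by independence of the coordinates.\<close>

lemma local_event_vimage:
  assumes "local_event J B" "finite J" "J \<subseteq> V"
  obtains X where "X \<in> sets (Pi\<^sub>M J \<mu>)" "B = (\<lambda>\<omega>. restrict \<omega> J) -` X \<inter> space P"
proof
  let ?X = "(\<lambda>\<omega>. restrict \<omega> J) ` B"
  have sub: "B \<subseteq> space P" using assms(1) sets.sets_into_space by (auto simp: local_event_def)
  have single: "{\<sigma>} \<in> sets (Pi\<^sub>M J \<mu>)" if "\<sigma> \<in> ?X" for \<sigma>
  proof -
    obtain \<omega> where w: "\<omega> \<in> space P" "\<sigma> = restrict \<omega> J" using \<open>\<sigma> \<in> ?X\<close> sub by blast
    then have "{\<sigma>} = (\<Pi>\<^sub>E i\<in>J. {\<sigma> i})" by (subst PiE_singleton) auto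
    also have "\<dots> \<in> sets (Pi\<^sub>M J \<mu>)"
      using assms w state_sub[OF w(1)] by (intro sets_PiM_I_finite) (auto simp: sets_\<mu>)
    finally show ?thesis .
  qed
  have fin: "finite ?X"
  proof (rule finite_subset)
    show "?X \<subseteq> (\<Pi>\<^sub>E i\<in>J. Pow (nbrs E i))" using sub assms state_sub by fastforce
    show "finite (\<Pi>\<^sub>E i\<in>J. Pow (nbrs E i))" using assms finite_nbrs by (intro finite_PiE) auto
  qed
  show "?X \<in> sets (Pi\<^sub>M J \<mu>)" by (rule sets.countable[OF single countable_finite[OF fin]])
  show "B = (\<lambda>\<omega>. restrict \<omega> J) -` ?X \<inter> space P"
  proof (intro equalityI subsetI)
    fix \<omega> assume w: "\<omega> \<in> (\<lambda>\<omega>. restrict \<omega> J) -` ?X \<inter> space P"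
    then obtain \<omega>' where w': "\<omega>' \<in> B" "restrict \<omega> J = restrict \<omega>' J" by auto
    have "\<forall>x\<in>J. \<omega> x = \<omega>' x" using w'(2) by (metis restrict_apply')
    moreover have "\<omega> \<in> space P" "\<omega>' \<in> space P" using w w'(1) sub by auto
    ultimately show "\<omega> \<in> B" using assms(1) w'(1) unfolding local_event_def by blast
  qed (use sub in auto)
qed

lemma indep_states: "indep_vars \<mu> (\<lambda>x \<omega>. \<omega> x) V"
proof (subst indep_vars_iff_distr_eq_PiM')
  show "V \<noteq> {}" using infinite_V by auto
  show "random_variable (\<mu> i) (\<lambda>\<omega>. \<omega> i)" if "i \<in> V" for i
    unfolding P_def using that by (rule measurable_component_singleton)
  have "distr P (Pi\<^sub>M V \<mu>) (\<lambda>x. \<lambda>i\<in>V. x i) = distr P P (\<lambda>x. x)"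
    by (intro distr_cong) (auto simp: P_def space_PiM PiE_def extensional_restrict)
  moreover have "(\<Pi>\<^sub>M i\<in>V. distr P (\<mu> i) (\<lambda>\<omega>. \<omega> i)) = Pi\<^sub>M V \<mu>"
    unfolding P_def by (intro PiM_cong refl distr_PiM_component prob_space_\<mu>)
  ultimately show "distr P (Pi\<^sub>M V \<mu>) (\<lambda>x. \<lambda>i\<in>V. x i) = (\<Pi>\<^sub>M i\<in>V. distr P (\<mu> i) (\<lambda>\<omega>. \<omega> i))"
    by (simp add: P_def)
qed

lemma prob_local_Int:
  assumes "local_event J A" "local_event K B" "finite J" "finite K" "J \<subseteq> V" "K \<subseteq> V" "J \<inter> K = {}"
  shows "prob (A \<inter> B) = prob A * prob B"
proof -
  obtain X where X: "X \<in> sets (Pi\<^sub>M J \<mu>)" "A = (\<lambda>\<omega>. restrict \<omega> J) -` X \<inter> space P"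
    using local_event_vimage[OF assms(1,3,5)] .
  obtain Y where Y: "Y \<in> sets (Pi\<^sub>M K \<mu>)" "B = (\<lambda>\<omega>. restrict \<omega> K) -` Y \<inter> space P"
    using local_event_vimage[OF assms(2,4,6)] .
  have "prob ((\<lambda>\<omega>. (restrict \<omega> J, restrict \<omega> K)) -` (X \<times> Y) \<inter> space P) = prob A * prob B"
    using indep_varD[OF indep_var_restrict[OF indep_states assms(7,5,6)] X(1) Y(1)] X(2) Y(2) by simp
  also have "(\<lambda>\<omega>. (restrict \<omega> J, restrict \<omega> K)) -` (X \<times> Y) \<inter> space P = A \<inter> B"
    using X(2) Y(2) by auto
  finally show ?thesis .
qed

definition approximable :: "('v \<Rightarrow> 'v set) set \<Rightarrow> bool" where
  "approximable A \<longleftrightarrow> (\<forall>\<epsilon>>0. \<exists>J B. finite J \<and> J \<subseteq> V \<and> local_event J B \<and> prob (sym_diff A B) < \<epsilon>)"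

lemma approximableD:
  assumes "approximable A" "\<epsilon> > 0"
  obtains J B where "finite J" "J \<subseteq> V" "local_event J B" "prob (sym_diff A B) < \<epsilon>"
  using assms unfolding approximable_def by blast

lemma approximable_UN:
  fixes A :: "nat \<Rightarrow> ('v \<Rightarrow> 'v set) set"
  assumes ev: "\<And>i. A i \<in> events" and ap: "\<And>i. approximable (A i)"
  shows "approximable (\<Union>i. A i)"
  unfolding approximable_def
proof (intro allI impI)
  fix \<epsilon> :: real assume "\<epsilon> > 0"
  let ?U = "\<Union>i. A i" and ?Un = "\<lambda>n. \<Union>i<n. A i"
  have "(\<lambda>n. prob (?Un n)) \<longlonglongrightarrow> prob (\<Union>n. ?Un n)"
    using ev by (intro finite_Lim_measure_incseq incseq_SucI) (auto simp: less_Suc_eq)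
  moreover have "(\<Union>n. ?Un n) = ?U" by auto
  ultimately have "(\<lambda>n. prob (?Un n)) \<longlonglongrightarrow> prob ?U" by simp
  then obtain n where n: "\<bar>prob (?Un n) - prob ?U\<bar> < \<epsilon> / 2"
    using \<open>\<epsilon> > 0\<close> LIMSEQ_D[of "\<lambda>n. prob (?Un n)" "prob ?U" "\<epsilon> / 2"] by (auto simp: real_norm_def)
  \<comment> \<open>Half of \<open>\<epsilon>\<close> is spent on cutting the union off at
    \<open>n\<close>; the other half is shared among the \<open>n\<close> approximations. The added
    1 keeps the share positive when \<open>n = 0\<close>.\<close>
  have "\<exists>J B. finite J \<and> J \<subseteq> V \<and> local_event J B \<and> prob (sym_diff (A i) B) < \<epsilon> / (2 * (real n + 1))" for i
    using ap[of i] \<open>\<epsilon> > 0\<close> unfolding approximable_def by simp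
  then obtain J B where JB: "\<And>i. finite (J i)" "\<And>i. J i \<subseteq> V" "\<And>i. local_event (J i) (B i)"
    "\<And>i. prob (sym_diff (A i) (B i)) < \<epsilon> / (2 * (real n + 1))" by metis
  have Bev: "B i \<in> events" for i using JB(3) by (simp add: local_event_def)
  have "local_event (\<Union>i<n. J i) (\<Union>i<n. B i)"
    unfolding local_event_def
  proof (intro conjI ballI impI)
    show "(\<Union>i<n. B i) \<in> events" using Bev by (intro sets.finite_UN) auto
    fix \<omega> \<omega>' assume w: "\<omega> \<in> space P" "\<omega>' \<in> space P" "\<forall>x\<in>(\<Union>i<n. J i). \<omega> x = \<omega>' x"
    have "\<omega> \<in> B i \<longleftrightarrow> \<omega>' \<in> B i" if "i < n" for i
    proof -
      have "\<forall>x\<in>J i. \<omega> x = \<omega>' x" using w(3) that by blast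
      with JB(3)[of i] w(1,2) show ?thesis unfolding local_event_def by blast
    qed
    then show "\<omega> \<in> (\<Union>i<n. B i) \<longleftrightarrow> \<omega>' \<in> (\<Union>i<n. B i)" by blast
  qed
  moreover have "prob (sym_diff ?U (\<Union>i<n. B i)) < \<epsilon>"
  proof -
    have "prob (sym_diff ?U (\<Union>i<n. B i)) \<le> prob ((?U - ?Un n) \<union> (\<Union>i<n. sym_diff (A i) (B i)))"
      using ev Bev by (intro finite_measure_mono) auto
    also have "\<dots> \<le> prob (?U - ?Un n) + prob (\<Union>i<n. sym_diff (A i) (B i))"
      using ev Bev by (intro measure_Un_le) auto
    also have "prob (?U - ?Un n) = prob ?U - prob (?Un n)"
      using ev by (intro finite_measure_Diff) auto
    also have "prob (\<Union>i<n. sym_diff (A i) (B i)) \<le> (\<Sum>i<n. prob (sym_diff (A i) (B i)))"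
      using ev Bev by (intro finite_measure_subadditive_finite) auto
    also have "\<dots> \<le> (\<Sum>i<n. \<epsilon> / (2 * (real n + 1)))" using JB(4) by (intro sum_mono less_imp_le)
    also have "\<dots> \<le> \<epsilon> / 2" using \<open>\<epsilon> > 0\<close> by (simp add: field_simps)
    finally show ?thesis using n by linarith
  qed
  ultimately show "\<exists>J B. finite J \<and> J \<subseteq> V \<and> local_event J B \<and> prob (sym_diff ?U B) < \<epsilon>"
    using JB(1,2) by (intro exI[of _ "\<Union>i<n. J i"] exI[of _ "\<Union>i<n. B i"]) auto
qed

text \<open>Approximable events contain the one-coordinate cylinders and are stable under
  complements and countable unions, so they exhaust the generated \<sigma>-algebra.\<close>

lemma approximable_event:
  assumes "A \<in> events"
  shows "approximable A"
proof -
  let ?G = "{{f \<in> \<Pi>\<^sub>E i\<in>V. space (\<mu> i). f i \<in> S} | i S. i \<in> V \<and> S \<in> sets (\<mu> i)}"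
  have sp: "(\<Pi>\<^sub>E i\<in>V. space (\<mu> i)) = space P" by (simp add: P_def space_PiM)
  have ev: "sigma_sets (space P) ?G = events" unfolding P_def sets_PiM_single space_PiM ..
  have "A \<in> sigma_sets (space P) ?G" using assms unfolding ev .
  then show ?thesis
  proof (induction rule: sigma_sets.induct)
    case (Basic a)
    then obtain S i where a: "a = {f \<in> space P. f i \<in> S}" "i \<in> V" "S \<in> sets (\<mu> i)"
      unfolding sp by blast
    have "a \<in> events" using sigma_sets.Basic[OF Basic, of "space P"] unfolding ev .
    then have "local_event {i} a" using a by (auto simp: local_event_def)
    then show ?case using a unfolding approximable_def by (intro allI impI exI[of _ "{i}"] exI[of _ a]) auto
  next
    case Empty
    then show ?case unfolding approximable_def
      by (intro allI impI exI[of _ "{}"]) (auto simp: local_event_def)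
  next
    case (Compl a)
    have a: "a \<in> events" using Compl(1) ev by simp
    show ?case unfolding approximable_def
    proof (intro allI impI)
      fix \<epsilon> :: real assume "\<epsilon> > 0"
      with Compl.IH obtain J B where B: "finite J" "J \<subseteq> V" "local_event J B" "prob (sym_diff a B) < \<epsilon>"
        by (rule approximableD)
      have sub: "B \<subseteq> space P" "a \<subseteq> space P"
        using B(3) a sets.sets_into_space by (auto simp: local_event_def)
      have "space P - B \<in> events" using B(3) unfolding local_event_def by blast
      then have "local_event J (space P - B)" using B(3) unfolding local_event_def by blast
      moreover have "sym_diff (space P - a) (space P - B) = sym_diff a B" using sub by blast
      ultimately show "\<exists>J B. finite J \<and> J \<subseteq> V \<and> local_event J B \<and> prob (sym_diff (space P - a) B) < \<epsilon>"
        using B by (intro exI[of _ J] exI[of _ "space P - B"]) auto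
    qed
  next
    case (Union a)
    then show ?case unfolding ev by (intro approximable_UN) auto
  qed
qed

lemma abs_prob_diff_le:
  assumes "A \<in> events" "B \<in> events"
  shows "\<bar>prob A - prob B\<bar> \<le> prob (sym_diff A B)"
proof -
  have "prob A \<le> prob (B \<union> sym_diff A B)" "prob B \<le> prob (A \<union> sym_diff A B)"
    using assms by (intro finite_measure_mono; auto)+
  moreover have "prob (B \<union> sym_diff A B) \<le> prob B + prob (sym_diff A B)"
    "prob (A \<union> sym_diff A B) \<le> prob A + prob (sym_diff A B)"
    using assms by (intro measure_Un_le; auto)+
  ultimately show ?thesis by simp
qed

lemma local_event_act:
  assumes "local_event J B" "aut f" "J \<subseteq> V"
  shows "local_event (inv_into V f ` J) (act f -` B \<inter> space P)"
proof -
  have "act f -` B \<inter> space P \<in> events"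
    using assms(1) by (intro measurable_sets[OF act_measurable[OF assms(2)]]) (simp add: local_event_def)
  moreover have "act f \<omega> \<in> B \<longleftrightarrow> act f \<omega>' \<in> B"
    if "\<omega> \<in> space P" "\<omega>' \<in> space P" "\<forall>x\<in>inv_into V f ` J. \<omega> x = \<omega>' x" for \<omega> \<omega>'
  proof -
    have "\<forall>x\<in>J. act f \<omega> x = act f \<omega>' x" using that(3) assms(3) by (auto simp: act_def)
    then show ?thesis using assms(1) act_space[OF assms(2)] that(1,2) unfolding local_event_def by blast
  qed
  ultimately show ?thesis unfolding local_event_def by blast
qed

text \<open>Approximate \<open>A\<close> by a local \<open>B\<close> and move the support of
  \<open>B\<close> off itself by an automorphism. By invariance \<open>A\<close> is equally close to
  the moved event, which is independent of \<open>B\<close> and has the same probability. In the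
  limit \<open>prob A = prob A * prob A\<close>.\<close>

lemma zero_one_law:
  assumes A: "A \<in> events" and inv: "\<And>f \<omega>. aut f \<Longrightarrow> \<omega> \<in> space P \<Longrightarrow> act f \<omega> \<in> A \<longleftrightarrow> \<omega> \<in> A"
  shows "prob A = 0 \<or> prob A = 1"
proof -
  have "\<bar>prob A - prob A * prob A\<bar> \<le> \<epsilon>" if "\<epsilon> > 0" for \<epsilon> :: real
  proof -
    \<comment> \<open>Two approximations enter the comparison with \<open>B \<inter> ?B\<close> and
      cost \<open>\<epsilon> / 2\<close>; comparing the squares costs
      \<open>\<epsilon> / 4 * 2\<close>.\<close>
    obtain J B where B: "finite J" "J \<subseteq> V" "local_event J B" "prob (sym_diff A B) < \<epsilon> / 4"
      using approximableD[OF approximable_event[OF A], of "\<epsilon> / 4"] \<open>\<epsilon> > 0\<close>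
      by (metis divide_pos_pos zero_less_numeral)
    obtain f where f: "aut f" "f ` J \<inter> J = {}" using ex_aut_disjoint[OF B(1,2)] .
    let ?B = "act f -` B \<inter> space P" and ?K = "inv_into V f ` J"
    have sub: "A \<subseteq> space P" using A sets.sets_into_space by blast
    have Bev: "B \<in> events" using B(3) by (simp add: local_event_def)
    have loc: "local_event ?K ?B" using local_event_act[OF B(3) f(1) B(2)] .
    then have B'ev: "?B \<in> events" by (simp add: local_event_def)
    have "?K \<subseteq> V" using B(2) aut_inv_V[OF f(1)] by blast
    moreover have "J \<inter> ?K = {}"
    proof (rule ccontr)
      assume "J \<inter> ?K \<noteq> {}"
      then obtain x where x: "x \<in> J" "inv_into V f x \<in> J" by blast
      then have "x \<in> f ` J" using aut_inv_r[OF f(1), of x] B(2) by (metis imageI subsetD)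
      with x f(2) show False by blast
    qed
    ultimately have "prob (B \<inter> ?B) = prob B * prob ?B"
      using prob_local_Int[OF B(3) loc] B by auto
    then have PB: "prob (B \<inter> ?B) = prob B * prob B" using prob_act[OF f(1) Bev] by simp
    have "sym_diff A ?B = act f -` sym_diff A B \<inter> space P"
      using inv[OF f(1)] sub by blast
    then have s': "prob (sym_diff A ?B) = prob (sym_diff A B)"
      using prob_act[OF f(1), of "sym_diff A B"] A Bev by simp
    have "\<bar>prob A - prob (B \<inter> ?B)\<bar> \<le> prob (sym_diff A (B \<inter> ?B))"
      using A Bev B'ev by (intro abs_prob_diff_le) auto
    also have "\<dots> \<le> prob (sym_diff A B \<union> sym_diff A ?B)"
      using A Bev B'ev by (intro finite_measure_mono) auto
    also have "\<dots> \<le> prob (sym_diff A B) + prob (sym_diff A ?B)"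
      using A Bev B'ev by (intro measure_Un_le) auto
    finally have 1: "\<bar>prob A - prob B * prob B\<bar> \<le> \<epsilon> / 2" using s' B(4) PB by linarith
    have 2: "\<bar>prob A - prob B\<bar> \<le> \<epsilon> / 4" using abs_prob_diff_le[OF A Bev] B(4) by linarith
    have "\<bar>prob A * prob A - prob B * prob B\<bar> = \<bar>prob A - prob B\<bar> * \<bar>prob A + prob B\<bar>"
      unfolding abs_mult[symmetric] by (simp add: algebra_simps)
    also have "\<dots> \<le> \<epsilon> / 4 * 2"
    proof (rule mult_mono[OF 2])
      show "\<bar>prob A + prob B\<bar> \<le> 2"
        using prob_le_1[of A] prob_le_1[of B] measure_nonneg[of P A] measure_nonneg[of P B] by linarith
    qed (use that in auto)
    finally show ?thesis using 1 by linarith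
  qed
  then have "prob A - prob A * prob A = 0"
    by (metis abs_ge_zero abs_le_zero_iff dense_ge)
  then have "prob A * (1 - prob A) = 0" by (simp add: algebra_simps)
  then show ?thesis by simp
qed
subsection \<open>Numbers of infinite clusters\<close>

abbreviation conn :: "('v \<Rightarrow> 'v set) \<Rightarrow> ('v \<times> 'v) set" where
  "conn \<omega> \<equiv> conn_in (und V \<omega>) V"

definition inf_at :: "('v \<Rightarrow> 'v set) \<Rightarrow> 'v \<Rightarrow> bool" where
  "inf_at \<omega> x \<longleftrightarrow> infinite (comp_in (und V \<omega>) V x)"

text \<open>This and the next two say "at least" one, two, three infinite clusters. Using
  representatives in the countable \<open>V\<close> instead of a cardinality makes measurability and
  invariance direct.\<close>

definition one_inf :: "('v \<Rightarrow> 'v set) \<Rightarrow> bool" where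
  "one_inf \<omega> \<longleftrightarrow> (\<exists>x\<in>V. inf_at \<omega> x)"

definition two_inf :: "('v \<Rightarrow> 'v set) \<Rightarrow> bool" where
  "two_inf \<omega> \<longleftrightarrow> (\<exists>x\<in>V. \<exists>y\<in>V. inf_at \<omega> x \<and> inf_at \<omega> y \<and> (x, y) \<notin> conn \<omega>)"

definition three_inf :: "('v \<Rightarrow> 'v set) \<Rightarrow> bool" where
  "three_inf \<omega> \<longleftrightarrow> (\<exists>x\<in>V. \<exists>y\<in>V. \<exists>z\<in>V. inf_at \<omega> x \<and> inf_at \<omega> y \<and> inf_at \<omega> z \<and>
     (x, y) \<notin> conn \<omega> \<and> (x, z) \<notin> conn \<omega> \<and> (y, z) \<notin> conn \<omega>)"

lemma inf_at_cong: "(x, y) \<in> conn \<omega> \<Longrightarrow> inf_at \<omega> x \<Longrightarrow> inf_at \<omega> y"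
  unfolding inf_at_def using infinite_comp_in_cong[OF sym_und] .

lemma conn_sym: "(x, y) \<in> conn \<omega> \<Longrightarrow> (y, x) \<in> conn \<omega>"
  using conn_in_sym[OF sym_und] .

lemma not_three_inf:
  assumes "\<not> three_inf \<omega>" "x \<in> V" "y \<in> V" "z \<in> V" "inf_at \<omega> x" "inf_at \<omega> y" "inf_at \<omega> z" "(x, y) \<notin> conn \<omega>"
  shows "(x, z) \<in> conn \<omega> \<or> (y, z) \<in> conn \<omega>"
  using assms unfolding three_inf_def by blast

lemma inf_at_mono:
  assumes "comp_in (und V \<omega>) V x \<subseteq> comp_in (und V \<omega>') V x" "inf_at \<omega> x"
  shows "inf_at \<omega>' x"
  using assms finite_subset unfolding inf_at_def by blast

lemma comp_in_upd_outside:
  assumes "x \<notin> W"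
  shows "comp_in (und V (\<omega> (x := S))) W y = comp_in (und V \<omega>) W y"
proof -
  have "und V (\<omega> (x := S)) \<inter> W \<times> W = und V \<omega> \<inter> W \<times> W"
    using assms by (auto simp: und_iff split: if_splits)
  then show ?thesis unfolding comp_in_def conn_in_def by simp
qed

text \<open>The state of \<open>x\<close> governs only arcs at \<open>x\<close>, so a cluster not
  containing \<open>x\<close> keeps all of its arcs. It may still grow, because the new state can
  point into it.\<close>

lemma comp_sub_upd:
  assumes "y \<in> V" "(y, x) \<notin> conn \<omega>"
  shows "comp_in (und V \<omega>) V y \<subseteq> comp_in (und V (\<omega> (x := S))) V y"
proof
  fix z assume z: "z \<in> comp_in (und V \<omega>) V y"
  have "comp_in (und V \<omega>) V y \<subseteq> V - {x}"
    using assms comp_in_subset[OF assms(1), of "und V \<omega>"] by (auto simp: comp_in_iff)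
  then have "(y, z) \<in> conn_in (und V \<omega>) (V - {x})"
    by (rule conn_in_within_comp[OF sym_und z assms(1)])
  then have "z \<in> comp_in (und V (\<omega> (x := S))) (V - {x}) y"
    by (subst comp_in_upd_outside) (auto simp: comp_in_iff)
  then show "z \<in> comp_in (und V (\<omega> (x := S))) V y"
    using comp_in_mono[of "und V (\<omega> (x := S))" "V - {x}" "und V (\<omega> (x := S))" V y] by auto
qed

text \<open>An infinite cluster of \<open>\<omega> (z := S)\<close> contains an infinite cluster of \<open>\<omega>\<close>, so joining the only two
  infinite clusters leaves a single one.\<close>

lemma merge:
  assumes sp: "\<omega> \<in> space P" "\<omega> (z := S) \<in> space P" and z: "z \<in> V"
    and xy: "x \<in> V" "y \<in> V" "inf_at \<omega> x" "inf_at \<omega> y" "(x, y) \<notin> conn \<omega>" and three: "\<not> three_inf \<omega>"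
    and x: "comp_in (und V \<omega>) V x \<subseteq> comp_in (und V (\<omega> (z := S))) V x"
    and y: "comp_in (und V \<omega>) V y \<subseteq> comp_in (und V (\<omega> (z := S))) V y"
    and joined: "(x, y) \<in> conn (\<omega> (z := S))"
  shows "\<not> two_inf (\<omega> (z := S))"
proof -
  let ?\<eta> = "\<omega> (z := S)"
  have to_x: "(x, u) \<in> conn ?\<eta>" if u: "u \<in> V" "inf_at ?\<eta> u" for u
  proof -
    \<comment> \<open>Away from \<open>z\<close> both configurations agree, so an infinite piece
      that remains after deleting \<open>z\<close> belongs to an infinite cluster of
      \<open>\<omega>\<close>.\<close>
    obtain v where v: "v \<in> V - {z}" "v \<in> comp_in (und V ?\<eta>) V u"
      "infinite (comp_in (und V ?\<eta>) (V - {z}) v)"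
      using infinite_comp_avoiding_finite[OF sym_und finite_und[OF sp(2)], of V u "{z}"] u z
      by (auto simp: inf_at_def)
    have "comp_in (und V ?\<eta>) (V - {z}) v = comp_in (und V \<omega>) (V - {z}) v"
      by (rule comp_in_upd_outside) simp
    also have "\<dots> \<subseteq> comp_in (und V \<omega>) V v" by (rule comp_in_mono) auto
    finally have "inf_at \<omega> v" using v(3) infinite_super unfolding inf_at_def by blast
    then have "(x, v) \<in> conn \<omega> \<or> (y, v) \<in> conn \<omega>" using not_three_inf[OF three xy(1,2) _ xy(3,4) _ xy(5)] v(1) by blast
    then have "(x, v) \<in> conn ?\<eta> \<or> (y, v) \<in> conn ?\<eta>" using x y unfolding comp_in_iff[symmetric] by blast
    then have "(x, v) \<in> conn ?\<eta>" using joined conn_in_trans by metis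
    moreover have "(v, u) \<in> conn ?\<eta>" using v(2) conn_sym by (simp add: comp_in_iff)
    ultimately show ?thesis by (rule conn_in_trans)
  qed
  show ?thesis
  proof
    assume "two_inf ?\<eta>"
    then obtain u v where "u \<in> V" "v \<in> V" "inf_at ?\<eta> u" "inf_at ?\<eta> v" "(u, v) \<notin> conn ?\<eta>"
      unfolding two_inf_def by blast
    then show False using to_x[of u] to_x[of v] conn_sym conn_in_trans by metis
  qed
qed

text \<open>
  If \<open>x\<close> and its neighbour \<open>y\<close> lie in different infinite clusters, choose \<open>u\<close> next to \<open>x\<close> whose cluster
  stays infinite after \<open>x\<close> is removed. Resetting \<open>x\<close> to a state of size at most 1 inside \<open>{u}\<close> keeps the
  clusters of \<open>u\<close> and \<open>y\<close> apart, and the state \<open>{u, y}\<close> then joins them.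
\<close>

lemma no_adjacent_infinite_clusters:
  assumes R: "mod_closed R" and two: "\<And>\<omega>. \<omega> \<in> R \<Longrightarrow> two_inf \<omega> \<and> \<not> three_inf \<omega>"
    and small: "p 0 > 0 \<or> p 1 > 0" and p2: "p 2 > 0"
    and w: "\<omega> \<in> R" and xy: "(x, y) \<in> E" "inf_at \<omega> x" "inf_at \<omega> y" "(x, y) \<notin> conn \<omega>"
  shows False
proof -
  have V: "x \<in> V" "y \<in> V" using xy(1) E_V by auto
  have sp: "\<omega> \<in> space P" using R w by (rule mod_closed_space)
  obtain u where u: "u \<in> V - {x}" "(x, u) \<in> und V \<omega>" "u \<in> comp_in (und V \<omega>) V x"
    "infinite (comp_in (und V \<omega>) (V - {x}) u)"
    using infinite_comp_minus_finite[OF sym_und finite_und[OF sp], of V x x "{x}"] xy(2) V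
    unfolding inf_at_def by auto
  have uy: "u \<noteq> y" using u(3) xy(4) by (auto simp: comp_in_iff)
  have uE: "(x, u) \<in> E" using und_sub_E[OF sp] u(2) by blast
  \<comment> \<open>Going from \<open>\<omega>\<close> straight to \<open>{u, y}\<close> could cut
    off another infinite piece of the cluster of \<open>x\<close>. Since \<open>x\<close> and
    \<open>u\<close> are already adjacent in \<open>\<omega>\<close>, the state \<open>T\<close>
    yields a configuration below both. It lies in \<open>R\<close>, so the clusters of
    \<open>u\<close> and \<open>y\<close> are its only infinite ones, and passing to
    \<open>{u, y}\<close> just adds arcs.\<close>
  define T where "T = (if p 0 > 0 then {} else {u})"
  have T: "allowed x T" "T \<subseteq> {u}" using small uE by (auto simp: T_def allowed_def nbrs_def)
  have T': "allowed x {u, y}" using p2 uE xy(1) uy by (auto simp: allowed_def nbrs_def numeral_2_eq_2)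
  let ?\<omega>1 = "\<omega> (x := T)" and ?\<omega>2 = "\<omega> (x := {u, y})"
  have R1: "?\<omega>1 \<in> R" and R2: "?\<omega>2 \<in> R" using R w V T T' by (auto intro: mod_closed_upd)
  have sp1: "?\<omega>1 \<in> space P" and sp2: "?\<omega>2 \<in> space P" using R R1 R2 by (auto intro: mod_closed_space)
  have upd: "?\<omega>1(x := {u, y}) = ?\<omega>2" by simp
  have sub1: "und V ?\<omega>1 \<subseteq> und V \<omega>"
  proof (rule subrelI)
    fix a b assume "(a, b) \<in> und V ?\<omega>1"
    then show "(a, b) \<in> und V \<omega>"
      using T(2) u(2) sym_und[of V \<omega>, THEN symD] by (auto simp: und_iff split: if_splits)
  qed
  have sub2: "und V ?\<omega>1 \<subseteq> und V ?\<omega>2" using T(2) by (auto simp: und_iff split: if_splits)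
  have c1: "conn ?\<omega>1 \<subseteq> conn \<omega>" using sub1 by (intro conn_in_mono) auto
  have c2: "comp_in (und V ?\<omega>1) V v \<subseteq> comp_in (und V ?\<omega>2) V v" for v
    using sub2 by (intro comp_in_mono) auto
  have "infinite (comp_in (und V ?\<omega>1) (V - {x}) u)" using u(4) by (subst comp_in_upd_outside) auto
  moreover have "comp_in (und V ?\<omega>1) (V - {x}) u \<subseteq> comp_in (und V ?\<omega>1) V u" by (rule comp_in_mono) auto
  ultimately have inf_u: "inf_at ?\<omega>1 u" unfolding inf_at_def using infinite_super by blast
  have inf_y: "inf_at ?\<omega>1 y"
    using comp_sub_upd[OF V(2), of x \<omega> T] xy(3,4) conn_sym by (blast intro: inf_at_mono)
  have nc: "(u, y) \<notin> conn ?\<omega>1"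
  proof
    assume "(u, y) \<in> conn ?\<omega>1"
    then have "(u, y) \<in> conn \<omega>" using c1 by blast
    with u(3) have "(x, y) \<in> conn \<omega>" unfolding comp_in_iff by (blast intro: conn_in_trans)
    with xy(4) show False ..
  qed
  have "(u, x) \<in> conn ?\<omega>2" "(x, y) \<in> conn ?\<omega>2"
    using V u(1) by (auto intro!: conn_in_step simp: und_iff)
  then have "(u, y) \<in> conn ?\<omega>2" by (rule conn_in_trans)
  then have "\<not> two_inf ?\<omega>2"
    using merge[of ?\<omega>1 x "{u, y}" u y, unfolded upd] sp1 sp2 V u(1) inf_u inf_y nc two[OF R1] c2 by blast
  then show False using two[OF R2] by blast
qed

text \<open>Strong induction on the length of a walk from \<open>x\<close> to \<open>y\<close>. If
  the next vertex \<open>x1\<close> lies in an infinite cluster, it is that of \<open>x\<close>,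
  which shortens the walk, or that of \<open>y\<close>, which is the adjacent case. If its cluster
  is finite, the state of \<open>x1\<close> affects neither infinite cluster, and
  \<open>{x, x2}\<close> extends that of \<open>x\<close> two steps along the walk.\<close>

lemma no_two_infinite_clusters_at_distance:
  assumes R: "mod_closed R" and two: "\<And>\<omega>. \<omega> \<in> R \<Longrightarrow> two_inf \<omega> \<and> \<not> three_inf \<omega>"
    and small: "p 0 > 0 \<or> p 1 > 0" and p2: "p 2 > 0"
  shows "\<omega> \<in> R \<Longrightarrow> (x, y) \<in> E ^^ n \<Longrightarrow> x \<in> V \<Longrightarrow> inf_at \<omega> x \<Longrightarrow> inf_at \<omega> y \<Longrightarrow> (x, y) \<notin> conn \<omega> \<Longrightarrow> False"
proof (induction n arbitrary: \<omega> x rule: less_induct)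
  case (less n)
  note w = less.prems(1) and xy = less.prems(4-6)
  have sp: "\<omega> \<in> space P" using R w by (rule mod_closed_space)
  have "x \<noteq> y" using xy(3) by auto
  then have "n \<noteq> 0" using less.prems(2) by (cases n) auto
  then obtain m where m: "n = Suc m" by (cases n) auto
  then obtain x1 where x1: "(x, x1) \<in> E" "(x1, y) \<in> E ^^ m"
    using less.prems(2) relpow_Suc_D2 by metis
  have V: "x \<in> V" "x1 \<in> V" using x1 E_V by auto
  have yV: "y \<in> V"
  proof -
    have "(x, y) \<in> E\<^sup>*" using less.prems(2) by (rule relpow_imp_rtrancl)
    then show ?thesis by (cases rule: rtranclE) (use V E_V in auto)
  qed
  have nothree: "\<not> three_inf \<omega>" using two[OF w] by blast
  show False
  proof (cases "inf_at \<omega> x1")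
    case True
    then consider "(x, x1) \<in> conn \<omega>" | "(y, x1) \<in> conn \<omega>" "(x, x1) \<notin> conn \<omega>"
      using not_three_inf[OF nothree V(1) yV V(2) xy(1,2) _ xy(3)] by blast
    then show False
    proof cases
      case 1
      have "(x1, y) \<notin> conn \<omega>" using 1 xy(3) conn_in_trans by metis
      then show False using less.IH[OF _ w x1(2) V(2) True xy(2)] m by simp
    next
      case 2
      then show False using no_adjacent_infinite_clusters[OF R two small p2 w x1(1) xy(1) True] by blast
    qed
  next
    case False
    then have "x1 \<noteq> y" using xy by auto
    then have "m \<noteq> 0" using x1(2) by (cases m) auto
    then obtain k where k: "m = Suc k" by (cases m) auto
    then obtain x2 where x2: "(x1, x2) \<in> E" "(x2, y) \<in> E ^^ k"
      using x1(2) relpow_Suc_D2 by metis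
    have x2V: "x2 \<in> V" using x2 E_V by auto
    show False
    proof (cases "x2 = x")
      \<comment> \<open>The walk backtracks: its tail of length \<open>k\<close> starts again at
        \<open>x\<close>.\<close>
      case True
      then show False using less.IH[OF _ w x2(2)] m k V xy by simp
    next
      case x2x: False
      let ?\<omega> = "\<omega> (x1 := {x, x2})"
      have "allowed x1 {x, x2}"
        using p2 x1(1) x2(1) x2x E_commute by (auto simp: allowed_def nbrs_def numeral_2_eq_2)
      then have R': "?\<omega> \<in> R" using R w V by (intro mod_closed_upd)
      then have sp': "?\<omega> \<in> space P" using R by (intro mod_closed_space)
      have nx: "(x, x1) \<notin> conn \<omega>" "(y, x1) \<notin> conn \<omega>" using False inf_at_cong xy by blast+
      have sub: "comp_in (und V \<omega>) V x \<subseteq> comp_in (und V ?\<omega>) V x"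
        "comp_in (und V \<omega>) V y \<subseteq> comp_in (und V ?\<omega>) V y"
        using comp_sub_upd nx V yV by auto
      then have inf: "inf_at ?\<omega> x" "inf_at ?\<omega> y" using xy inf_at_mono by blast+
      \<comment> \<open>Had the new state joined the two clusters, only one infinite cluster would
        be left, which is impossible in \<open>R\<close>.\<close>
      have nc: "(x, y) \<notin> conn ?\<omega>"
        using merge[OF sp sp' V(2) V(1) yV xy nothree sub] two[OF R'] by blast
      have "(x, x1) \<in> conn ?\<omega>" "(x1, x2) \<in> conn ?\<omega>"
        using V x2V by (auto intro!: conn_in_step simp: und_iff)
      then have c: "(x, x2) \<in> conn ?\<omega>" by (rule conn_in_trans)
      then have nc2: "(x2, y) \<notin> conn ?\<omega>" using nc conn_in_trans by metis
      have "k < n" using m k by simp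
      then show False using less.IH[OF _ R' x2(2) x2V inf_at_cong[OF c inf(1)] inf(2) nc2] by blast
    qed
  qed
qed

lemma not_exactly_two:
  assumes "p 0 > 0 \<or> p 1 > 0" "p 2 > 0"
  shows "\<not> (AE \<omega> in P. two_inf \<omega> \<and> \<not> three_inf \<omega>)"
proof
  assume "AE \<omega> in P. two_inf \<omega> \<and> \<not> three_inf \<omega>"
  then obtain R where R: "mod_closed R" "R \<noteq> {}" "\<And>\<omega>. \<omega> \<in> R \<Longrightarrow> two_inf \<omega> \<and> \<not> three_inf \<omega>"
    by (rule AE_mod_closed) blast
  then obtain \<omega> where w: "\<omega> \<in> R" by blast
  then obtain x y where xy: "x \<in> V" "y \<in> V" "inf_at \<omega> x" "inf_at \<omega> y" "(x, y) \<notin> conn \<omega>"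
    using R(3) unfolding two_inf_def by blast
  then have "(x, y) \<in> E\<^sup>*" using connected by (simp add: connected_graph_def)
  then obtain n where "(x, y) \<in> E ^^ n" using rtrancl_power by blast
  then show False
    using no_two_infinite_clusters_at_distance[OF R(1,3) assms w _ xy(1,3-5)] by blast
qed
subsection \<open>Trifurcation sets\<close>

text \<open>The infinite branches are represented by adjacent vertices \<open>u\<close>,
  \<open>v\<close>, \<open>w\<close>, so that all quantifiers range over countable sets and, for
  fixed \<open>B\<close>, measurability is immediate.\<close>

definition trif :: "('v \<Rightarrow> 'v set) \<Rightarrow> 'v set \<Rightarrow> bool" where
  "trif \<omega> B \<longleftrightarrow> B \<noteq> {} \<and> connected_in (und V \<omega>) B \<and>
     (\<exists>u\<in>V - B. \<exists>v\<in>V - B. \<exists>w\<in>V - B.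
        (\<forall>a\<in>{u, v, w}. infinite (comp_in (und V \<omega>) (V - B) a) \<and> (\<exists>b\<in>B. (b, a) \<in> und V \<omega>)) \<and>
        (u, v) \<notin> conn_in (und V \<omega>) (V - B) \<and> (u, w) \<notin> conn_in (und V \<omega>) (V - B) \<and>
        (v, w) \<notin> conn_in (und V \<omega>) (V - B))"

definition good :: "nat \<Rightarrow> ('v \<Rightarrow> 'v set) \<Rightarrow> 'v \<Rightarrow> bool" where
  "good r \<omega> x \<longleftrightarrow> (\<exists>B\<in>Pow (gball E x r). trif \<omega> B)"

lemma measurable_trif:
  assumes "B \<subseteq> V"
  shows "Measurable.pred P (\<lambda>\<omega>. trif \<omega> B)"
proof -
  have c: "countable B" "countable (V - B)" using assms countable_V countable_subset by blast+
  have b: "countable {u, v, w}" for u v w :: 'v by simp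
  show ?thesis
    unfolding trif_def connected_in_def
    using assms by (intro pred_intros_logic measurable_pred_countable c b measurable_conn_in
        measurable_infinite_comp_in measurable_und) auto
qed

lemma measurable_good:
  assumes "x \<in> V"
  shows "Measurable.pred P (\<lambda>\<omega>. good r \<omega> x)"
  unfolding good_def
  using gball_V[OF assms, of r] finite_gball[of x r]
  by (intro measurable_pred_countable measurable_trif countable_finite) auto

lemma good_events: "x \<in> V \<Longrightarrow> {\<omega> \<in> space P. good r \<omega> x} \<in> events"
  using measurable_good unfolding pred_def .

lemma trif_act:
  assumes f: "aut f" and sp: "\<omega> \<in> space P" and B: "B \<subseteq> V"
  shows "trif (act f \<omega>) (f ` B) \<longleftrightarrow> trif \<omega> B"
proof -
  have inj: "inj_on f V" using aut_inj[OF f] .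
  have im: "V - f ` B = f ` (V - B)"
    using inj_on_image_set_diff[OF inj, of V B] aut_image[OF f] B by auto
  have und: "(f b, f a) \<in> und V (act f \<omega>) \<longleftrightarrow> (b, a) \<in> und V \<omega>" if "a \<in> V" "b \<in> V" for a b
  proof
    assume "(f b, f a) \<in> und V (act f \<omega>)"
    then obtain b' a' where ba: "(b', a') \<in> und V \<omega>" "f b = f b'" "f a = f a'"
      unfolding und_act[OF f sp] by auto
    then have "a = a'" "b = b'" using that inj und_sub_V[OF sp] by (auto simp: inj_on_eq_iff)
    with ba show "(b, a) \<in> und V \<omega>" by simp
  qed (auto simp: und_act[OF f sp])
  have con: "connected_in (und V (act f \<omega>)) (f ` B) \<longleftrightarrow> connected_in (und V \<omega>) B"
    unfolding connected_in_def Set.ball_simps(9)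
    using B by (intro ball_cong refl conn_in_act[OF f sp B]) auto
  have c: "(f a, f b) \<in> conn_in (und V (act f \<omega>)) (f ` (V - B)) \<longleftrightarrow> (a, b) \<in> conn_in (und V \<omega>) (V - B)"
    if "a \<in> V - B" "b \<in> V - B" for a b
    using that by (intro conn_in_act[OF f sp]) auto
  have i: "infinite (comp_in (und V (act f \<omega>)) (f ` (V - B)) (f a)) \<longleftrightarrow> infinite (comp_in (und V \<omega>) (V - B) a)"
    if "a \<in> V - B" for a
    using that by (intro infinite_comp_in_act[OF f sp]) auto
  have e: "(\<exists>b\<in>f ` B. (b, f a) \<in> und V (act f \<omega>)) \<longleftrightarrow> (\<exists>b\<in>B. (b, a) \<in> und V \<omega>)" if "a \<in> V - B" for a
    using that und B by auto
  show ?thesis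
    unfolding trif_def im con Set.bex_simps(7) image_is_empty
    using c i e by (intro conj_cong refl bex_cong) simp_all
qed

lemma good_act:
  assumes "aut f" "\<omega> \<in> space P" "x \<in> V"
  shows "good r (act f \<omega>) (f x) \<longleftrightarrow> good r \<omega> x"
proof -
  have eq: "Pow (gball E (f x) r) = (\<lambda>B. f ` B) ` Pow (gball E x r)"
    using aut_image_gball[OF assms(1,3)] by (metis image_Pow_surj)
  then show ?thesis
    unfolding good_def eq Set.bex_simps(7)
    using gball_V[OF assms(3), of r] by (intro bex_cong refl trif_act[OF assms(1,2)]) auto
qed

lemma prob_good_eq:
  assumes "x \<in> V" "y \<in> V"
  shows "prob {\<omega> \<in> space P. good r \<omega> x} = prob {\<omega> \<in> space P. good r \<omega> y}"
proof -
  obtain f where f: "aut f" "f x = y" using transitive assms by (auto simp: vertex_transitive_def)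
  have eq: "act f -` {\<omega> \<in> space P. good r \<omega> y} \<inter> space P = {\<omega> \<in> space P. good r \<omega> x}"
    using good_act[OF f(1) _ assms(1), of _ r] act_space[OF f(1)] f(2) by auto
  show ?thesis using prob_act[OF f(1) good_events[OF assms(2)], of r] unfolding eq .
qed

text \<open>Deletion is applied twice, to \<open>B\<close> and then to \<open>y\<close>. The exit
  vertex \<open>y\<close> will receive a new state, so the infinite piece has to be one that does
  not use \<open>y\<close>; \<open>w\<close> is its contact point.\<close>

lemma infinite_escape:
  assumes "\<omega> \<in> space P" "finite B" "B \<subseteq> V" "x \<in> B" "inf_at \<omega> x"
  obtains z y w where "z \<in> B" "y \<in> V - B" "(z, y) \<in> E" "(y, w) \<in> E" "w \<in> V - B - {y}"
    "(x, y) \<in> conn \<omega>" "(y, w) \<in> conn \<omega>" "infinite (comp_in (und V \<omega>) (V - B - {y}) w)"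
proof -
  note fin = finite_und[OF assms(1)] and sub = und_sub_E[OF assms(1)]
  have xV: "x \<in> V" using assms by blast
  obtain z y where zy: "z \<in> B" "z \<in> comp_in (und V \<omega>) V x" "y \<in> V - B" "(z, y) \<in> und V \<omega>"
    "y \<in> comp_in (und V \<omega>) V x" "infinite (comp_in (und V \<omega>) (V - B) y)"
    using infinite_comp_minus_finite[OF sym_und fin assms(5)[unfolded inf_at_def] assms(4,2) xV comp_in_self] .
  obtain y' w where w: "y' \<in> {y}" "w \<in> V - B - {y}" "(y', w) \<in> und V \<omega>"
    "infinite (comp_in (und V \<omega>) (V - B - {y}) w)"
    using infinite_comp_minus_finite[OF sym_und fin zy(6) singletonI _ zy(3) comp_in_self] by blast
  then have yw: "(y, w) \<in> und V \<omega>" by simp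
  have "(y, w) \<in> conn \<omega>" using yw w(2) zy(3) by (intro conn_in_step) auto
  then show ?thesis using that[of z y w] zy(1,3-5) w(2,4) yw sub by (auto simp: comp_in_iff)
qed

text \<open>Every vertex other than the centre points to one strictly closer to the centre;
  following these arcs descends to \<open>x\<close> without leaving the ball.\<close>

lemma conn_in_gball:
  assumes "x \<in> V" and step: "\<And>b. b \<in> gball E x n \<Longrightarrow> b \<noteq> x \<Longrightarrow> \<exists>a\<in>\<omega> b. \<exists>k. b \<notin> gball E x k \<and> a \<in> gball E x k"
  shows "k \<le> n \<Longrightarrow> b \<in> gball E x k \<Longrightarrow> (b, x) \<in> conn_in (und V \<omega>) (gball E x n)"
proof (induction k arbitrary: b rule: less_induct)
  case (less k)
  have bn: "b \<in> gball E x n" using less.prems gball_mono[of k n E x] by blast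
  show ?case
  proof (cases "b = x")
    case False
    obtain a j where a: "a \<in> \<omega> b" "b \<notin> gball E x j" "a \<in> gball E x j" using step[OF bn False] by blast
    then have jk: "j < k" using less.prems(2) gball_mono[of k j E x] by (meson linorder_not_le subsetD)
    then have "(a, x) \<in> conn_in (und V \<omega>) (gball E x n)" using less.IH a(3) less.prems(1) by simp
    moreover have "a \<in> gball E x n" using a(3) jk less.prems(1) gball_mono[of j n E x] by auto
    then have "(b, a) \<in> conn_in (und V \<omega>) (gball E x n)"
      using a(1) bn gball_V[OF assms(1)] by (intro conn_in_step) (auto simp: und_iff)
    ultimately show ?thesis by (rule conn_in_trans[rotated])
  qed simp
qed

text \<open>
  Take a ball \<open>B\<close> meeting three infinite clusters, and add to it for each of them an exit vertex \<open>y\<close>.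
  States of size 2 suffice: ball vertices point to the centre, and \<open>y\<close> points to one vertex of \<open>B\<close> and
  to one vertex \<open>w\<close> of an infinite piece outside.
\<close>

lemma create_trif:
  assumes R: "mod_closed R" and w: "\<omega> \<in> R" and three: "three_inf \<omega>" and p2: "p 2 > 0" and v0: "v0 \<in> V"
  shows "\<exists>\<eta>\<in>R. \<exists>r. good r \<eta> v0"
proof -
  have sp: "\<omega> \<in> space P" using R w by (rule mod_closed_space)
  obtain x1 x2 x3 where x: "x1 \<in> V" "x2 \<in> V" "x3 \<in> V" "inf_at \<omega> x1" "inf_at \<omega> x2" "inf_at \<omega> x3"
    "(x1, x2) \<notin> conn \<omega>" "(x1, x3) \<notin> conn \<omega>" "(x2, x3) \<notin> conn \<omega>"
    using three unfolding three_inf_def by blast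
  define X where "X = {x1, x2, x3}"
  have X: "finite X" "X \<subseteq> V" using x by (auto simp: X_def)
  have sep: "a = b" if "a \<in> X" "b \<in> X" "(a, b) \<in> conn \<omega>" for a b
    using that x(7-9) conn_sym unfolding X_def by blast
  obtain n where n: "X \<subseteq> gball E v0 n" using finite_sub_gball[OF v0 X] by blast
  define B where "B = gball E v0 n"
  have B: "finite B" "B \<subseteq> V" using finite_gball gball_V[OF v0] by (auto simp: B_def)
  define Q where "Q a z y w \<longleftrightarrow> z \<in> B \<and> y \<in> V - B \<and> (z, y) \<in> E \<and> (y, w) \<in> E \<and> w \<in> V - B - {y} \<and>
      (a, y) \<in> conn \<omega> \<and> (y, w) \<in> conn \<omega> \<and> infinite (comp_in (und V \<omega>) (V - B - {y}) w)" for a z y w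
  have "\<exists>z y w. Q a z y w" if "a \<in> X" for a
  proof -
    have "a \<in> B" "inf_at \<omega> a" using that n x by (auto simp: B_def X_def)
    then show ?thesis using infinite_escape[OF sp B] unfolding Q_def by metis
  qed
  then obtain Z Y W where "\<And>a. a \<in> X \<Longrightarrow> Q a (Z a) (Y a) (W a)" by metis
  then have zyw: "\<And>a. a \<in> X \<Longrightarrow> Z a \<in> B" "\<And>a. a \<in> X \<Longrightarrow> Y a \<in> V - B"
    "\<And>a. a \<in> X \<Longrightarrow> (Z a, Y a) \<in> E" "\<And>a. a \<in> X \<Longrightarrow> (Y a, W a) \<in> E" "\<And>a. a \<in> X \<Longrightarrow> W a \<in> V - B - {Y a}"
    "\<And>a. a \<in> X \<Longrightarrow> (a, Y a) \<in> conn \<omega>" "\<And>a. a \<in> X \<Longrightarrow> (Y a, W a) \<in> conn \<omega>"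
    "\<And>a. a \<in> X \<Longrightarrow> infinite (comp_in (und V \<omega>) (V - B - {Y a}) (W a))"
    unfolding Q_def by blast+
  have aW: "(a, W a) \<in> conn \<omega>" if "a \<in> X" for a using zyw(6,7)[OF that] by (rule conn_in_trans)
  have Y_inj: "a = b" if "a \<in> X" "b \<in> X" "Y a = Y b" for a b
    using sep[OF that(1,2)] zyw(6)[OF that(1)] zyw(6)[OF that(2)] that(3) conn_sym conn_in_trans by metis
  define B' where "B' = B \<union> Y ` X"
  have B': "finite B'" "B' \<subseteq> V" using B X zyw(2) by (auto simp: B'_def)
  \<comment> \<open>Size 2 forces a second target besides the one closer to the centre. It is an
    arbitrary different neighbour, and the centre takes any two neighbours.\<close>
  have "\<forall>b\<in>B. \<exists>S. allowed b S \<and> (b \<noteq> v0 \<longrightarrow> (\<exists>a\<in>S. \<exists>k. b \<notin> gball E v0 k \<and> a \<in> gball E v0 k))"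
  proof
    fix b assume b: "b \<in> B"
    have pair: "allowed b {a, c}" if "(b, a) \<in> E" "(b, c) \<in> E" "c \<noteq> a" for a c
      using that p2 by (auto simp: allowed_def nbrs_def numeral_2_eq_2)
    show "\<exists>S. allowed b S \<and> (b \<noteq> v0 \<longrightarrow> (\<exists>a\<in>S. \<exists>k. b \<notin> gball E v0 k \<and> a \<in> gball E v0 k))"
    proof (cases "b = v0")
      case True
      obtain a where "(b, a) \<in> E" using ex_edge v0 True by blast
      moreover obtain c where "(b, c) \<in> E" "c \<noteq> a" using other_nbr v0 True by blast
      ultimately show ?thesis using pair True by blast
    next
      case False
      then obtain k a where a: "b \<notin> gball E v0 k" "a \<in> gball E v0 k" "(a, b) \<in> E"
        using gball_parent[of b E v0 n] b unfolding B_def by blast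
      moreover obtain c where "(b, c) \<in> E" "c \<noteq> a" using other_nbr b B by blast
      ultimately show ?thesis using pair[of a c] E_commute by blast
    qed
  qed
  then obtain \<tau> where \<tau>: "\<And>b. b \<in> B \<Longrightarrow> allowed b (\<tau> b)"
    "\<And>b. b \<in> B \<Longrightarrow> b \<noteq> v0 \<Longrightarrow> \<exists>a\<in>\<tau> b. \<exists>k. b \<notin> gball E v0 k \<and> a \<in> gball E v0 k" by metis
  \<comment> \<open>At an exit vertex, inverting \<open>Y\<close> recovers the cluster that it
    serves; \<open>Y\<close> is injective because its values lie in different clusters.\<close>
  define \<sigma> where "\<sigma> = (\<lambda>b. if b \<in> B then \<tau> b else let a = the_inv_into X Y b in {Z a, W a})"
  have \<sigma>Y: "\<sigma> (Y a) = {Z a, W a}" if "a \<in> X" for a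
    using that zyw(2)[OF that] the_inv_into_f_f[of Y X a] Y_inj by (auto simp: \<sigma>_def inj_on_def)
  have \<sigma>: "allowed b (\<sigma> b)" if bB': "b \<in> B'" for b
  proof (cases "b \<in> B")
    case True
    then show ?thesis using \<tau>(1) by (simp add: \<sigma>_def)
  next
    case False
    then obtain a where a: "a \<in> X" "b = Y a" using bB' by (auto simp: B'_def)
    have "Z a \<noteq> W a" using zyw(1,5)[OF a(1)] by force
    then show ?thesis
      using \<sigma>Y[OF a(1)] a(2) zyw(3,4)[OF a(1)] p2 E_commute
      by (auto simp: allowed_def nbrs_def numeral_2_eq_2)
  qed
  define \<eta> where "\<eta> = (\<lambda>x. if x \<in> B' then \<sigma> x else \<omega> x)"
  have \<eta>R: "\<eta> \<in> R" unfolding \<eta>_def using R w B' \<sigma> by (rule mod_closed_override)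
  have toB: "(b, v0) \<in> conn_in (und V \<eta>) B'" if "b \<in> B" for b
  proof -
    have "(b, v0) \<in> conn_in (und V \<eta>) (gball E v0 n)"
    proof (rule conn_in_gball[OF v0 _ order_refl])
      show "b \<in> gball E v0 n" using that by (simp add: B_def)
      fix c assume "c \<in> gball E v0 n" "c \<noteq> v0"
      then show "\<exists>a\<in>\<eta> c. \<exists>k. c \<notin> gball E v0 k \<and> a \<in> gball E v0 k"
        using \<tau>(2)[of c] by (simp add: \<eta>_def \<sigma>_def B'_def B_def)
    qed
    then show ?thesis using conn_in_mono[of "und V \<eta>" "gball E v0 n" "und V \<eta>" B'] by (auto simp: B'_def B_def)
  qed
  have Y\<eta>: "(Y a, Z a) \<in> und V \<eta>" "(Y a, W a) \<in> und V \<eta>" if "a \<in> X" for a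
    using \<sigma>Y[OF that] that zyw(2)[OF that] by (auto simp: und_iff \<eta>_def B'_def)
  have toB': "(b, v0) \<in> conn_in (und V \<eta>) B'" if bB': "b \<in> B'" for b
  proof (cases "b \<in> B")
    case False
    then obtain a where a: "a \<in> X" "b = Y a" using bB' by (auto simp: B'_def)
    have "(b, Z a) \<in> conn_in (und V \<eta>) B'"
      using Y\<eta>(1)[OF a(1)] zyw(1)[OF a(1)] a bB' by (intro conn_in_step) (auto simp: B'_def)
    then show ?thesis using toB[OF zyw(1)[OF a(1)]] by (rule conn_in_trans)
  qed (rule toB)
  have conB': "connected_in (und V \<eta>) B'"
    unfolding connected_in_def using toB' conn_in_sym[OF sym_und] conn_in_trans by metis
  have WB': "W a \<in> V - B'" if "a \<in> X" for a
  proof -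
    have "W a \<noteq> Y b" if "b \<in> X" for b
    proof
      assume "W a = Y b"
      then have "(a, b) \<in> conn \<omega>"
        using aW[OF \<open>a \<in> X\<close>] conn_sym[OF zyw(6)[OF that]] conn_in_trans by metis
      then have "a = b" using sep \<open>a \<in> X\<close> that by blast
      with \<open>W a = Y b\<close> show False using zyw(5)[OF that] by simp
    qed
    then show ?thesis using zyw(5)[OF that] by (auto simp: B'_def)
  qed
  \<comment> \<open>A changed state affects only arcs with an end in \<open>B'\<close>, wherever its
    second target lies, so nothing changes outside \<open>B'\<close>.\<close>
  have eq: "und V \<eta> \<inter> (V - B') \<times> (V - B') = und V \<omega> \<inter> (V - B') \<times> (V - B')"
    by (auto simp: und_iff \<eta>_def)
  then have ceq: "conn_in (und V \<eta>) (V - B') = conn_in (und V \<omega>) (V - B')" by (simp add: conn_in_def)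
  have infW: "infinite (comp_in (und V \<eta>) (V - B') (W a))" if a: "a \<in> X" for a
  proof -
    let ?C = "comp_in (und V \<omega>) (V - B - {Y a}) (W a)"
    have sub: "?C \<subseteq> V - B - {Y a}" using zyw(5)[OF a] by (rule comp_in_subset)
    \<comment> \<open>The piece avoids its own exit vertex by construction and the others because
      they lie in different clusters of \<open>\<omega>\<close>; it therefore survives the deletion
      of all of \<open>B'\<close>.\<close>
    have "Y b \<notin> ?C" if "b \<in> X" for b
    proof
      assume Yb: "Y b \<in> ?C"
      have "?C \<subseteq> comp_in (und V \<omega>) V (W a)" by (rule comp_in_mono) auto
      with Yb have "(W a, Y b) \<in> conn \<omega>" by (auto simp: comp_in_iff)
      then have "(a, b) \<in> conn \<omega>"
        using aW[OF a] conn_sym[OF zyw(6)[OF that]] conn_in_trans by metis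
      then have "a = b" using sep a that by blast
      with Yb sub show False by blast
    qed
    then have "?C \<subseteq> V - B'" using sub by (auto simp: B'_def)
    then have "?C \<subseteq> comp_in (und V \<omega>) (V - B') (W a)"
      using conn_in_within_comp[OF sym_und _ zyw(5)[OF a]] by (auto simp: comp_in_iff[of _ _ "V - B'"])
    then show ?thesis using zyw(8)[OF a] infinite_super unfolding comp_in_def ceq by blast
  qed
  have sepW: "(W a, W b) \<notin> conn_in (und V \<eta>) (V - B')" if "a \<in> X" "b \<in> X" "a \<noteq> b" for a b
  proof
    assume "(W a, W b) \<in> conn_in (und V \<eta>) (V - B')"
    moreover have "conn_in (und V \<omega>) (V - B') \<subseteq> conn \<omega>" by (rule conn_in_mono) auto
    ultimately have "(W a, W b) \<in> conn \<omega>" unfolding ceq by blast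
    then have "(a, b) \<in> conn \<omega>" using aW[OF that(1)] conn_sym[OF aW[OF that(2)]] conn_in_trans by metis
    with sep that show False by blast
  qed
  have ne: "x1 \<noteq> x2" "x1 \<noteq> x3" "x2 \<noteq> x3" using x by auto
  have adj: "\<exists>b\<in>B'. (b, W a) \<in> und V \<eta>" if "a \<in> X" for a
    using Y\<eta>(2)[OF that] that by (auto simp: B'_def)
  have X123: "x1 \<in> X" "x2 \<in> X" "x3 \<in> X" by (auto simp: X_def)
  have "v0 \<in> B'" by (simp add: B'_def B_def)
  have "trif \<eta> B'"
    unfolding trif_def
    using \<open>v0 \<in> B'\<close> conB' WB' infW adj sepW ne X123
    by (intro conjI bexI[of _ "W x1"] bexI[of _ "W x2"] bexI[of _ "W x3"]) auto
  moreover have "B' \<subseteq> gball E v0 (Suc n)"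
    using zyw(1,3) by (auto simp: B'_def B_def)
  ultimately show ?thesis using \<eta>R unfolding good_def by blast
qed

text \<open>If every radius had probability 0, almost surely no radius would work. The resulting
  modification-closed set would contain no good configuration, although \<open>create_trif\<close>
  builds one inside it.\<close>

lemma good_positive:
  assumes "AE \<omega> in P. three_inf \<omega>" "p 2 > 0" "v0 \<in> V"
  obtains r where "prob {\<omega> \<in> space P. good r \<omega> v0} > 0"
proof (rule ccontr)
  assume "\<not> thesis"
  then have "prob {\<omega> \<in> space P. good r \<omega> v0} = 0" for r
    using that zero_less_measure_iff by metis
  then have "AE \<omega> in P. \<not> good r \<omega> v0" for r
    using prob_eq_0[OF good_events[OF assms(3)]] by (auto elim: AE_mp)
  then have "AE \<omega> in P. three_inf \<omega> \<and> (\<forall>r. \<not> good r \<omega> v0)"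
    using assms(1) by (simp add: AE_all_countable)
  then obtain R where R: "mod_closed R" "R \<noteq> {}" "\<And>\<omega>. \<omega> \<in> R \<Longrightarrow> three_inf \<omega> \<and> (\<forall>r. \<not> good r \<omega> v0)"
    by (rule AE_mod_closed) blast
  then obtain \<omega> where "\<omega> \<in> R" by blast
  then show False using create_trif[OF R(1) _ _ assms(2,3)] R(3) by blast
qed
subsection \<open>Counting trifurcation sets in a finite set\<close>

text \<open>Open arcs are edges of \<open>E\<close>, so a path leaving \<open>F\<close> passes
  through an inner boundary vertex; without one the component would stay in the finite
  \<open>F\<close>.\<close>

lemma infinite_comp_meets_boundary:
  assumes sp: "\<omega> \<in> space P" and F: "finite F" and w: "w \<in> F" "w \<in> W" "W \<subseteq> V"
    and inf: "infinite (comp_in (und V \<omega>) W w)"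
  shows "comp_in (und V \<omega>) W w \<inter> inner_boundary V E F \<noteq> {}"
proof
  assume no: "comp_in (und V \<omega>) W w \<inter> inner_boundary V E F = {}"
  have "y \<in> F" if "y \<in> comp_in (und V \<omega>) W w" for y
  proof -
    have "(w, y) \<in> (und V \<omega> \<inter> W \<times> W)\<^sup>*" using that by (simp add: comp_in_iff conn_in_def)
    then show ?thesis
    proof (induction rule: rtrancl_induct)
      case (step y z)
      then have "y \<in> comp_in (und V \<omega>) W w" by (simp add: comp_in_iff conn_in_def)
      with no have "y \<notin> inner_boundary V E F" by blast
      moreover have "(y, z) \<in> E" "z \<in> V" using step(2) und_sub_E[OF sp] w(3) by auto
      ultimately show ?case using step.IH by (auto simp: inner_boundary_def)
    qed (rule w(1))
  qed
  then have "comp_in (und V \<omega>) W w \<subseteq> F" by blast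
  with inf F show False using finite_subset by blast
qed

text \<open>Choose one trifurcation in the ball of each centre; disjoint balls make them distinct.
  As the balls avoid the inner boundary, the vertices attached to a trifurcation are still in
  \<open>F\<close>, so each infinite branch reaches the boundary and the combinatorial count applies
  with the boundary as \<open>Y\<close>.\<close>

lemma card_good_le:
  assumes sp: "\<omega> \<in> space P" and F: "finite F" "F \<subseteq> V"
    and X: "X \<subseteq> V" "\<And>x. x \<in> X \<Longrightarrow> gball E x r \<subseteq> F - inner_boundary V E F"
    and disj: "\<And>x y. x \<in> X \<Longrightarrow> y \<in> X \<Longrightarrow> x \<noteq> y \<Longrightarrow> gball E x r \<inter> gball E y r = {}"
    and good: "\<And>x. x \<in> X \<Longrightarrow> good r \<omega> x"
  shows "card X \<le> card (inner_boundary V E F)"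
proof -
  have "\<forall>x\<in>X. \<exists>B. B \<subseteq> gball E x r \<and> trif \<omega> B" using good unfolding good_def by blast
  then obtain \<beta> where \<beta>: "\<And>x. x \<in> X \<Longrightarrow> \<beta> x \<subseteq> gball E x r" "\<And>x. x \<in> X \<Longrightarrow> trif \<omega> (\<beta> x)" by metis
  have ne: "\<beta> x \<noteq> {}" if "x \<in> X" for x using \<beta>(2)[OF that] by (simp add: trif_def)
  have dis: "\<beta> x \<inter> \<beta> y = {}" if "x \<in> X" "y \<in> X" "x \<noteq> y" for x y
    using disj[OF that] \<beta>(1)[OF that(1)] \<beta>(1)[OF that(2)] by blast
  then have inj: "inj_on \<beta> X" using ne by (intro inj_onI) (metis inf.idem)
  have "x \<in> F" if "x \<in> X" for x using subsetD[OF X(2)[OF that] gball_self] by blast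
  then have finX: "finite X" using F finite_subset by (metis subsetI)
  have finY: "finite (inner_boundary V E F)" using F by (simp add: inner_boundary_def)
  have "card (\<beta> ` X) \<le> card (inner_boundary V E F)"
  proof (rule card_trifurcations_le[OF sym_und[of V \<omega>] _ finY])
    show "finite (\<beta> ` X)" using finX by simp
    show "B \<noteq> {} \<and> B \<subseteq> V \<and> connected_in (und V \<omega>) B" if "B \<in> \<beta> ` X" for B
    proof -
      from that obtain x where x: "x \<in> X" "B = \<beta> x" by blast
      have "gball E x r \<subseteq> V" using X(1) x(1) by (intro gball_V) auto
      then show ?thesis using \<beta>[OF x(1)] x(2) unfolding trif_def by blast
    qed
    show "B \<inter> B' = {}" if "B \<in> \<beta> ` X" "B' \<in> \<beta> ` X" "B \<noteq> B'" for B B'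
      using that dis by blast
    fix B assume "B \<in> \<beta> ` X"
    then obtain x where x: "x \<in> X" "B = \<beta> x" by blast
    have BF: "B \<subseteq> F - inner_boundary V E F" using \<beta>(1)[OF x(1)] X(2)[OF x(1)] x(2) by blast
    obtain u v w where uvw: "u \<in> V - B" "v \<in> V - B" "w \<in> V - B"
      "\<And>a. a \<in> {u, v, w} \<Longrightarrow> infinite (comp_in (und V \<omega>) (V - B) a)"
      "\<And>a. a \<in> {u, v, w} \<Longrightarrow> \<exists>b\<in>B. (b, a) \<in> und V \<omega>"
      "(u, v) \<notin> conn_in (und V \<omega>) (V - B)" "(u, w) \<notin> conn_in (und V \<omega>) (V - B)"
      "(v, w) \<notin> conn_in (und V \<omega>) (V - B)"
      using \<beta>(2)[OF x(1)] unfolding x(2)[symmetric] trif_def by blast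
    let ?C = "comp_in (und V \<omega>) (V - B)"
    have br: "branch (und V \<omega>) V B (?C a) \<and> ?C a \<inter> inner_boundary V E F \<noteq> {}" if a: "a \<in> {u, v, w}" for a
    proof
      have aV: "a \<in> V - B" using a uvw(1-3) by blast
      obtain b where b: "b \<in> B" "(b, a) \<in> und V \<omega>" using uvw(5)[OF a] by blast
      then show "branch (und V \<omega>) V B (?C a)" using aV unfolding branch_def by blast
      have "(b, a) \<in> E" using b(2) und_sub_E[OF sp] by blast
      then have "a \<in> F" using b(1) BF aV by (auto simp: inner_boundary_def)
      then show "?C a \<inter> inner_boundary V E F \<noteq> {}"
        using infinite_comp_meets_boundary[OF sp F(1) _ aV _ uvw(4)[OF a]] by blast
    qed
    have diff: "?C a \<noteq> ?C b" if "(a, b) \<notin> conn_in (und V \<omega>) (V - B)" for a b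
      using that comp_in_self[of b "und V \<omega>" "V - B"] comp_in_iff by metis
    have "?C u \<noteq> ?C v" "?C u \<noteq> ?C w" "?C v \<noteq> ?C w" using uvw(6-8) diff by blast+
    moreover have "\<forall>A\<in>{?C u, ?C v, ?C w}. branch (und V \<omega>) V B A \<and> A \<inter> inner_boundary V E F \<noteq> {}"
      using br by (intro ballI) (elim insertE emptyE; simp)
    ultimately show "\<exists>A1 A2 A3. A1 \<noteq> A2 \<and> A1 \<noteq> A3 \<and> A2 \<noteq> A3 \<and>
        (\<forall>A\<in>{A1, A2, A3}. branch (und V \<omega>) V B A \<and> A \<inter> inner_boundary V E F \<noteq> {})"
      by (intro exI[of _ "?C u"] exI[of _ "?C v"] exI[of _ "?C w"] conjI)
  qed
  then show ?thesis using card_image[OF inj] by simp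
qed

text \<open>The pointwise bound is applied to the random set of good centres and integrated; by
  transitivity every centre contributes the same probability.\<close>

lemma expected_good_le:
  assumes F: "finite F" "F \<subseteq> V"
    and X: "X \<subseteq> V" "\<And>x. x \<in> X \<Longrightarrow> gball E x r \<subseteq> F - inner_boundary V E F"
    and disj: "\<And>x y. x \<in> X \<Longrightarrow> y \<in> X \<Longrightarrow> x \<noteq> y \<Longrightarrow> gball E x r \<inter> gball E y r = {}"
    and v0: "v0 \<in> V"
  shows "real (card X) * prob {\<omega> \<in> space P. good r \<omega> v0} \<le> real (card (inner_boundary V E F))"
proof -
  let ?G = "\<lambda>x. {\<omega> \<in> space P. good r \<omega> x}"
  have "x \<in> F" if "x \<in> X" for x using subsetD[OF X(2)[OF that] gball_self] by blast
  then have finX: "finite X" using F finite_subset by (metis subsetI)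
  have ev: "?G x \<in> events" if "x \<in> X" for x using that X(1) by (intro good_events) auto
  have "real (card X) * prob (?G v0) = (\<Sum>x\<in>X. prob (?G x))"
  proof -
    have "prob (?G x) = prob (?G v0)" if "x \<in> X" for x using that X(1) v0 by (intro prob_good_eq) auto
    then show ?thesis by simp
  qed
  also have "\<dots> = (\<Sum>x\<in>X. expectation (indicator (?G x)))" using ev by (intro sum.cong) auto
  also have "\<dots> = expectation (\<lambda>\<omega>. \<Sum>x\<in>X. indicator (?G x) \<omega>)"
    using ev by (intro Bochner_Integration.integral_sum[symmetric]) (auto simp: emeasure_eq_measure)
  also have "\<dots> \<le> real (card (inner_boundary V E F))"
  proof (rule integral_le_const)
    show "integrable P (\<lambda>\<omega>. \<Sum>x\<in>X. indicator (?G x) \<omega> :: real)"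
      using ev by (intro Bochner_Integration.integrable_sum) (auto simp: emeasure_eq_measure)
    show "AE \<omega> in P. (\<Sum>x\<in>X. indicator (?G x) \<omega>) \<le> real (card (inner_boundary V E F))"
    proof (rule AE_I2)
      fix \<omega> assume sp: "\<omega> \<in> space P"
      let ?X = "{x \<in> X. good r \<omega> x}"
      have "(\<Sum>x\<in>X. indicator (?G x) \<omega>) = (\<Sum>x\<in>X. if good r \<omega> x then 1 else (0 :: real))"
        using sp by (intro sum.cong) auto
      also have "\<dots> = real (card ?X)" using finX by (simp add: sum.If_cases Int_def)
      also have "\<dots> \<le> real (card (inner_boundary V E F))"
      proof -
        have "card ?X \<le> card (inner_boundary V E F)"
        proof (rule card_good_le[OF sp F])
          show "?X \<subseteq> V" using X(1) by blast
          show "gball E x r \<subseteq> F - inner_boundary V E F" if "x \<in> ?X" for x using that X(2) by blast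
          show "gball E x r \<inter> gball E y r = {}" if "x \<in> ?X" "y \<in> ?X" "x \<noteq> y" for x y
            using that disj by blast
        qed blast
        then show ?thesis by simp
      qed
      finally show "(\<Sum>x\<in>X. indicator (?G x) \<omega>) \<le> real (card (inner_boundary V E F))" .
    qed
  qed
  finally show ?thesis .
qed

text \<open>In a maximal separated set every further vertex has a ball meeting a chosen one, so the
  balls of doubled radius cover \<open>F\<close>. The factor bounds the size of such a ball.\<close>

lemma ex_separated_subset:
  assumes "finite F" "F \<subseteq> V"
  obtains X where "X \<subseteq> F" "\<And>x y. x \<in> X \<Longrightarrow> y \<in> X \<Longrightarrow> x \<noteq> y \<Longrightarrow> gball E x r \<inter> gball E y r = {}"
    "card F \<le> card X * (d + 1) ^ (r + r)"
proof -
  define sep where "sep = (\<lambda>X. \<forall>x\<in>X. \<forall>y\<in>X. x \<noteq> y \<longrightarrow> gball E x r \<inter> gball E y r = {})"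
  have "finite {X. X \<subseteq> F \<and> sep X}" using assms(1) by simp
  moreover have "{} \<in> {X. X \<subseteq> F \<and> sep X}" by (simp add: sep_def)
  ultimately obtain X where X: "X \<in> {X. X \<subseteq> F \<and> sep X}"
    and max: "\<And>Y. Y \<in> {X. X \<subseteq> F \<and> sep X} \<Longrightarrow> X \<subseteq> Y \<Longrightarrow> X = Y"
    using finite_has_maximal[of "{X. X \<subseteq> F \<and> sep X}"] by auto
  have finX: "finite X" using X assms finite_subset by auto
  have "F \<subseteq> (\<Union>x\<in>X. gball E x (r + r))"
  proof
    fix y assume y: "y \<in> F"
    show "y \<in> (\<Union>x\<in>X. gball E x (r + r))"
    proof (cases "y \<in> X")
      case True
      then show ?thesis by (intro UN_I[of y]) auto
    next
      case False
      then have "\<not> sep (insert y X)" using max[of "insert y X"] X y by auto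
      then obtain x z where "x \<in> X" "z \<in> gball E x r" "z \<in> gball E y r"
        using X unfolding sep_def by blast
      then have "y \<in> gball E x (r + r)" using gball_sym[OF E_sym] gball_trans by metis
      with \<open>x \<in> X\<close> show ?thesis by blast
    qed
  qed
  then have "card F \<le> card (\<Union>x\<in>X. gball E x (r + r))"
    using finX finite_gball by (intro card_mono) auto
  also have "\<dots> \<le> (\<Sum>x\<in>X. card (gball E x (r + r)))" by (rule card_UN_le[OF finX])
  also have "\<dots> \<le> (\<Sum>x\<in>X. (d + 1) ^ (r + r))"
    using X assms by (intro sum_mono card_gball) auto
  finally have "card F \<le> card X * (d + 1) ^ (r + r)" by simp
  with X show ?thesis using that[of X] by (auto simp: sep_def)
qed

text \<open>With \<open>M = (d + 1) ^ (r + r)\<close>, at least \<open>card F / M\<close> separated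
  centres exist. Those whose ball touches the boundary number at most \<open>M\<close> per boundary
  vertex; the others obey \<open>expected_good_le\<close>. Multiplying out gives
  \<open>M + M ^ 2\<close> per boundary vertex, which is at most \<open>2 * M ^ 2\<close>.\<close>

lemma isoperimetric:
  assumes F: "finite F" "F \<subseteq> V" and v0: "v0 \<in> V"
  shows "prob {\<omega> \<in> space P. good r \<omega> v0} * real (card F) \<le>
    2 * real ((d + 1) ^ (r + r)) ^ 2 * real (card (inner_boundary V E F))"
proof -
  let ?\<tau> = "prob {\<omega> \<in> space P. good r \<omega> v0}" and ?Y = "inner_boundary V E F" and ?M = "(d + 1) ^ (r + r)"
  obtain X where X: "X \<subseteq> F" "\<And>x y. x \<in> X \<Longrightarrow> y \<in> X \<Longrightarrow> x \<noteq> y \<Longrightarrow> gball E x r \<inter> gball E y r = {}"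
    "card F \<le> card X * ?M" using ex_separated_subset[OF F] by blast
  have finX: "finite X" using X(1) F(1) finite_subset by blast
  have finY: "finite ?Y" and YV: "?Y \<subseteq> V" using F by (auto simp: inner_boundary_def)
  define X' where "X' = {x \<in> X. gball E x r \<inter> ?Y = {}}"
  have inside: "gball E x r \<subseteq> F - ?Y" if x: "x \<in> X'" for x
  proof -
    \<comment> \<open>A ball that starts in \<open>F\<close> and avoids the inner boundary cannot
      leave \<open>F\<close>, by induction on the radius.\<close>
    have "y \<in> F" if "y \<in> gball E x k" "k \<le> r" for y k
      using that
    proof (induction k arbitrary: y)
      case 0
      then show ?case using x X(1) by (auto simp: X'_def)
    next
      case (Suc k)
      then consider "y \<in> gball E x k" | z where "z \<in> gball E x k" "(z, y) \<in> E" by auto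
      then show ?case
      proof cases
        case 2
        have "z \<in> F" using Suc 2 by simp
        moreover have "z \<notin> ?Y" using 2(1) x gball_mono[of k r E x] Suc.prems(2) by (auto simp: X'_def)
        ultimately show ?thesis using 2(2) E_V by (auto simp: inner_boundary_def)
      qed (use Suc in simp)
    qed
    then show ?thesis using x by (auto simp: X'_def)
  qed
  have 1: "real (card X') * ?\<tau> \<le> real (card ?Y)"
    using X(1,2) F inside by (intro expected_good_le[OF F _ _ _ v0]) (auto simp: X'_def)
  have "X - X' \<subseteq> (\<Union>y\<in>?Y. gball E y r)"
    using gball_sym[OF E_sym] by (fastforce simp: X'_def)
  then have "card (X - X') \<le> card (\<Union>y\<in>?Y. gball E y r)"
    using finY finite_gball by (intro card_mono) auto
  also have "\<dots> \<le> (\<Sum>y\<in>?Y. card (gball E y r))" by (rule card_UN_le[OF finY])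
  also have "\<dots> \<le> (\<Sum>y\<in>?Y. ?M)"
  proof (rule sum_mono)
    fix y assume "y \<in> ?Y"
    then have "card (gball E y r) \<le> (d + 1) ^ r" using YV card_gball by blast
    also have "\<dots> \<le> ?M" by (intro power_increasing) auto
    finally show "card (gball E y r) \<le> ?M" .
  qed
  finally have 2: "card (X - X') \<le> card ?Y * ?M" by simp
  have "card X = card X' + card (X - X')"
  proof -
    have sub: "X' \<subseteq> X" unfolding X'_def by blast
    then show ?thesis
      using card_Diff_subset[OF finite_subset[OF sub finX] sub] card_mono[OF finX sub] by linarith
  qed
  then have "card X \<le> card X' + card ?Y * ?M" using 2 by linarith
  then have "card X * ?M \<le> (card X' + card ?Y * ?M) * ?M" by (rule mult_le_mono1)
  with X(3) have "card F \<le> (card X' + card ?Y * ?M) * ?M" by (rule le_trans)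
  then have "real (card F) \<le> (real (card X') + real (card ?Y) * real ?M) * real ?M"
    by (metis of_nat_add of_nat_mono of_nat_mult)
  then have "?\<tau> * real (card F) \<le> ?\<tau> * ((real (card X') + real (card ?Y) * real ?M) * real ?M)"
    by (rule mult_left_mono) simp
  also have "\<dots> = (real (card X') * ?\<tau>) * real ?M + ?\<tau> * (real (card ?Y) * real ?M ^ 2)"
    by (simp add: algebra_simps power2_eq_square)
  also have "\<dots> \<le> real (card ?Y) * real ?M + 1 * (real (card ?Y) * real ?M ^ 2)"
    using 1 by (intro add_mono mult_right_mono) auto
  also have "\<dots> \<le> real (card ?Y) * real ?M ^ 2 + 1 * (real (card ?Y) * real ?M ^ 2)"
  proof -
    have "real ?M \<ge> 1" by (simp add: one_le_power)
    then have "real ?M \<le> real ?M ^ 2" by (simp add: power2_eq_square)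
    then show ?thesis by (intro add_right_mono mult_left_mono) auto
  qed
  finally show ?thesis by (simp add: algebra_simps)
qed

text \<open>\<open>isoperimetric\<close> bounds the boundary ratio below by one positive constant
  for all non-empty finite sets, whereas amenability supplies sets for which its limsup is
  0.\<close>

lemma not_three:
  assumes am: "amenable_graph V E" and p2: "p 2 > 0"
  shows "\<not> (AE \<omega> in P. three_inf \<omega>)"
proof
  assume three: "AE \<omega> in P. three_inf \<omega>"
  obtain v0 where v0: "v0 \<in> V" using infinite_V by fastforce
  obtain r where r: "prob {\<omega> \<in> space P. good r \<omega> v0} > 0" using good_positive[OF three p2 v0] .
  define \<tau> where "\<tau> = prob {\<omega> \<in> space P. good r \<omega> v0}"
  define K where "K = 2 * real ((d + 1) ^ (r + r)) ^ 2"
  have \<tau>: "\<tau> > 0" and K: "K > 0" using r by (auto simp: \<tau>_def K_def)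
  obtain F where F: "\<And>n. F n \<noteq> {}" "\<And>n. finite (F n)" "\<And>n. F n \<subseteq> V"
    and lim: "limsup (\<lambda>n. ereal (real (card (inner_boundary V E (F n))) / real (card (F n)))) = 0"
    using am unfolding amenable_graph_def by blast
  have "\<tau> / K \<le> real (card (inner_boundary V E (F n))) / real (card (F n))" for n
  proof -
    have "\<tau> * real (card (F n)) \<le> K * real (card (inner_boundary V E (F n)))"
      unfolding \<tau>_def K_def using F v0 by (intro isoperimetric) auto
    moreover have "real (card (F n)) > 0" using F by (simp add: card_gt_0_iff)
    ultimately show ?thesis using K by (simp add: field_simps)
  qed
  then have "ereal (\<tau> / K) \<le> limsup (\<lambda>n. ereal (real (card (inner_boundary V E (F n))) / real (card (F n))))"
    by (intro le_Limsup) auto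
  then show False using lim \<tau> K by (simp add: zero_ereal_def divide_le_0_iff)
qed

subsection \<open>Uniqueness\<close>

lemma measurable_inf_at: "x \<in> V \<Longrightarrow> Measurable.pred P (\<lambda>\<omega>. inf_at \<omega> x)"
  unfolding inf_at_def by (rule measurable_infinite_comp_in) auto

lemma events_inf:
  "{\<omega> \<in> space P. one_inf \<omega>} \<in> events" "{\<omega> \<in> space P. two_inf \<omega>} \<in> events"
  "{\<omega> \<in> space P. three_inf \<omega>} \<in> events"
  unfolding one_inf_def two_inf_def three_inf_def pred_def[symmetric]
  by (intro measurable_pred_countable pred_intros_logic measurable_inf_at measurable_conn_in countable_V order_refl; assumption)+

lemma inf_at_act:
  assumes "aut f" "\<omega> \<in> space P" "x \<in> V"
  shows "inf_at (act f \<omega>) (f x) \<longleftrightarrow> inf_at \<omega> x"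
  using infinite_comp_in_act[OF assms(1,2) order_refl assms(3)] unfolding inf_at_def aut_image[OF assms(1)] .

lemma conn_act:
  assumes "aut f" "\<omega> \<in> space P" "x \<in> V" "y \<in> V"
  shows "(f x, f y) \<in> conn (act f \<omega>) \<longleftrightarrow> (x, y) \<in> conn \<omega>"
  using conn_in_act[OF assms(1,2) order_refl assms(3,4)] unfolding aut_image[OF assms(1)] .

lemma aut_bex: "aut f \<Longrightarrow> (\<exists>x\<in>V. Q x) \<longleftrightarrow> (\<exists>x\<in>V. Q (f x))"
  using aut_image by (metis imageE imageI)

lemma inf_act:
  assumes f: "aut f" and sp: "\<omega> \<in> space P"
  shows "one_inf (act f \<omega>) \<longleftrightarrow> one_inf \<omega>" "two_inf (act f \<omega>) \<longleftrightarrow> two_inf \<omega>"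
    "three_inf (act f \<omega>) \<longleftrightarrow> three_inf \<omega>"
proof -
  note act = inf_at_act[OF f sp] conn_act[OF f sp]
  show "one_inf (act f \<omega>) \<longleftrightarrow> one_inf \<omega>"
    unfolding one_inf_def
    by (subst aut_bex[OF f], rule bex_cong[OF refl]) (simp add: act)
  show "two_inf (act f \<omega>) \<longleftrightarrow> two_inf \<omega>"
    unfolding two_inf_def
    by (subst aut_bex[OF f], rule bex_cong[OF refl], subst aut_bex[OF f], rule bex_cong[OF refl])
      (simp add: act)
  show "three_inf (act f \<omega>) \<longleftrightarrow> three_inf \<omega>"
    unfolding three_inf_def
    by (subst aut_bex[OF f], rule bex_cong[OF refl], subst aut_bex[OF f], rule bex_cong[OF refl],
        subst aut_bex[OF f], rule bex_cong[OF refl]) (simp add: act)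
qed

lemma zero_one_inf:
  "prob {\<omega> \<in> space P. one_inf \<omega>} = 0 \<or> prob {\<omega> \<in> space P. one_inf \<omega>} = 1"
  "prob {\<omega> \<in> space P. two_inf \<omega>} = 0 \<or> prob {\<omega> \<in> space P. two_inf \<omega>} = 1"
  "prob {\<omega> \<in> space P. three_inf \<omega>} = 0 \<or> prob {\<omega> \<in> space P. three_inf \<omega>} = 1"
  by (rule zero_one_law; simp add: events_inf inf_act act_space)+

lemma weak_conn_eq: "weak_conn V \<omega> = conn \<omega> \<inter> V \<times> V" if "\<omega> \<in> space P"
  using und_sub_V[OF that] by (simp add: weak_conn_def und_def conn_in_def Int_absorb2)

lemma weak_cluster_of_eq:
  assumes "\<omega> \<in> space P" "x \<in> V"
  shows "weak_cluster_of V \<omega> x = comp_in (und V \<omega>) V x"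
  using comp_in_subset[OF assms(2), of "und V \<omega>"] assms(2)
  by (auto simp: weak_cluster_of_def weak_conn_eq[OF assms(1)] comp_in_def)

lemma num_infinite_clusters_eq_1_iff:
  assumes sp: "\<omega> \<in> space P"
  shows "num_infinite_clusters V \<omega> = 1 \<longleftrightarrow> one_inf \<omega> \<and> \<not> two_inf \<omega>"
proof -
  let ?C = "comp_in (und V \<omega>) V"
  define I where "I = {C \<in> weak_clusters V \<omega>. infinite C}"
  have "weak_clusters V \<omega> = ?C ` V"
    unfolding weak_clusters_def quotient_def using weak_cluster_of_eq[OF sp]
    by (auto simp: weak_cluster_of_def)
  then have "I = {C \<in> ?C ` V. infinite C}" unfolding I_def by simp
  then have I: "I = ?C ` {x \<in> V. inf_at \<omega> x}" unfolding inf_at_def by auto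
  have eq_iff: "?C x = ?C y \<longleftrightarrow> (x, y) \<in> conn \<omega>" for x y
    using comp_in_eq[OF sym_und, of x y V \<omega> V] comp_in_self[of y "und V \<omega>" V] comp_in_iff by metis
  have "num_infinite_clusters V \<omega> = 1 \<longleftrightarrow> finite I \<and> card I = 1"
    unfolding num_infinite_clusters_def I_def[symmetric] by (simp add: one_enat_def)
  \<comment> \<open>An infinite \<open>I\<close> has \<open>card I = 0\<close>, so
    \<open>card I = 1\<close> already decides the matter.\<close>
  also have "\<dots> \<longleftrightarrow> (\<exists>C. I = {C})"
    unfolding card_1_singleton_iff[symmetric] One_nat_def using card_ge_0_finite[of I] by auto
  also have "\<dots> \<longleftrightarrow> I \<noteq> {} \<and> (\<forall>C\<in>I. \<forall>D\<in>I. C = D)"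
  proof
    assume *: "I \<noteq> {} \<and> (\<forall>C\<in>I. \<forall>D\<in>I. C = D)"
    have "is_singleton I"
    proof (rule is_singletonI')
      show "I \<noteq> {}" using * ..
      fix C D assume "C \<in> I" "D \<in> I"
      with * show "C = D" by simp
    qed
    then show "\<exists>C. I = {C}" by (simp add: is_singleton_def)
  qed (elim exE, simp)
  also have "\<dots> \<longleftrightarrow> one_inf \<omega> \<and> \<not> two_inf \<omega>"
    unfolding I Set.ball_simps(9) eq_iff one_inf_def two_inf_def by auto
  finally show ?thesis .
qed

lemma AE_unique_infinite_cluster:
  assumes am: "amenable_graph V E" and v0: "v0 \<in> V" and perc: "percolation_prob V E v0 d p > 0"
    and small: "p 0 > 0 \<or> p 1 > 0" and p2: "p 2 > 0"
  shows "prob {\<omega> \<in> space P. num_infinite_clusters V \<omega> = 1} = 1"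
proof -
  have "{\<omega> \<in> space P. infinite (weak_cluster_of V \<omega> v0)} \<subseteq> {\<omega> \<in> space P. one_inf \<omega>}"
    using v0 weak_cluster_of_eq unfolding one_inf_def inf_at_def by fastforce
  then have "prob {\<omega> \<in> space P. infinite (weak_cluster_of V \<omega> v0)} \<le> prob {\<omega> \<in> space P. one_inf \<omega>}"
    using events_inf(1) by (rule finite_measure_mono)
  then have "prob {\<omega> \<in> space P. one_inf \<omega>} \<noteq> 0" using perc by (simp add: percolation_prob_def)
  then have one: "AE \<omega> in P. one_inf \<omega>"
    using zero_one_inf(1) prob_Collect_eq_1[OF events_inf(1)] by blast
  have nthree: "AE \<omega> in P. \<not> three_inf \<omega>"
    using zero_one_inf(3) not_three[OF am p2] prob_Collect_eq_1[OF events_inf(3)]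
      prob_Collect_eq_0[OF events_inf(3)] by blast
  have "AE \<omega> in P. \<not> two_inf \<omega>"
  proof (rule ccontr)
    assume "\<not> ?thesis"
    then have "AE \<omega> in P. two_inf \<omega>"
      using zero_one_inf(2) prob_Collect_eq_1[OF events_inf(2)] prob_Collect_eq_0[OF events_inf(2)] by blast
    with nthree have "AE \<omega> in P. two_inf \<omega> \<and> \<not> three_inf \<omega>" by (simp add: AE_conj_iff)
    with not_exactly_two[OF small p2] show False ..
  qed
  then have "prob {\<omega> \<in> space P. two_inf \<omega>} = 0" using prob_Collect_eq_0[OF events_inf(2)] by blast
  moreover have "prob {\<omega> \<in> space P. one_inf \<omega>} = 1" using one prob_Collect_eq_1[OF events_inf(1)] by blast
  moreover have "{\<omega> \<in> space P. two_inf \<omega>} \<in> null_sets P"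
    using calculation(1) events_inf(2) by (simp add: null_sets_def emeasure_eq_measure)
  ultimately have "prob ({\<omega> \<in> space P. one_inf \<omega>} - {\<omega> \<in> space P. two_inf \<omega>}) = 1"
    using measure_Diff_null_set events_inf(1) by metis
  moreover have "{\<omega> \<in> space P. num_infinite_clusters V \<omega> = 1} =
      {\<omega> \<in> space P. one_inf \<omega>} - {\<omega> \<in> space P. two_inf \<omega>}"
    using num_infinite_clusters_eq_1_iff by blast
  ultimately show ?thesis by simp
qed

end

theorem theorem16:
  fixes V :: "'v set" and E :: "('v \<times> 'v) set" and v\<^sub>0 :: 'v
    and d :: nat and p :: "nat \<Rightarrow> real"
  assumes "countable V" and "infinite V" and "v\<^sub>0 \<in> V"
    and "simple_digraph V E"
    and "regular_graph V E d"
    and "connected_graph V E"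
    and "vertex_transitive V E"
    and "amenable_graph V E"
    and "prob_vector d p"
    and "percolation_prob V E v\<^sub>0 d p > 0"
    and "p 0 + p 1 > 0" and "p 2 > 0"
  shows "measure (config_measure V E d p)
           {\<omega> \<in> space (config_measure V E d p). num_infinite_clusters V \<omega> = 1} = 1"
proof -
  interpret percolation V E d p by unfold_locales fact+
  have "p 0 > 0 \<or> p 1 > 0" using assms(11) by linarith
  with assms show ?thesis by (intro AE_unique_infinite_cluster)
qed

end
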